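(* For all positive integers $k,p,r$ with $p<2\lfloor\sqrt k\rfloor$, there exists a simple $k$-plane graph $G$ that has a unique minimum edge cut $T$, with $|T|=p$, such that for any two distinct edges $t_1,t_2\in T$ the corresponding subdivision vertices $\tilde t_1,\tilde t_2$ satisfy $d_F(\tilde t_1,\tilde t_2)\ge r$ in $\Lambda(\tilde G)$.
   Context: A drawing of a graph maps the vertices to distinct points of the plane and each edge to a curve (a homeomorphic image of $[0,1]$) joining the images of its endpoints whose interior contains no vertex. A crossing is a point interior to two distinct edges; no third edge passes through it, and the two edges cross transversally there. An embedded graph is a graph with such a drawing; it is $k$-plane if every edge contains at most $k$ crossing points and no two edge-curves share more than one point. The planarization $H^\times$ is obtained by inserting a dummy-vertex at every crossing point; $\Lambda(H)$ is obtained from $H^\times$ by inserting inside each face of $H^\times$ a face-vertex adjacent to all vertices of $H^\times$ on that face's boundary; the radial graph $R(H)$ is the subgraph of $\Lambda(H)$ formed by all edges incident to face-vertices; the face-distance $d_F(u,v)$ is the number of face-vertices on a shortest $u$–$v$ path in $R(H)$. $\tilde G$ is the embedded graph obtained from $G$ by subdividing every edge $t$ once by a vertex $\tilde t$ placed on the curve of $t$ between one endpoint and the first crossing point of $t$. An edge cut is a set of edges whose removal disconnects the graph; a minimum edge cut is one of minimum size. *)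

theory Defs
  imports "HOL-Analysis.Analysis" "HOL-Library.Extended_Nat"
begin

section \<open>Graphs\<close>

text \<open>A finite simple graph: vertex set V (of naturals), edge set E of 2-element subsets of V.\<close>
definition simple_graph :: "nat set \<Rightarrow> nat set set \<Rightarrow> bool" where
  "simple_graph V E \<longleftrightarrow> finite V \<and> (\<forall>e\<in>E. e \<subseteq> V \<and> card e = 2)"

definition graph_connected :: "nat set \<Rightarrow> nat set set \<Rightarrow> bool" where
  "graph_connected V E \<longleftrightarrow>
     (\<forall>u\<in>V. \<forall>v\<in>V. (u, v) \<in> {(x, y). {x, y} \<in> E}\<^sup>*)"

definition edge_cut :: "nat set \<Rightarrow> nat set set \<Rightarrow> nat set set \<Rightarrow> bool" where
  "edge_cut V E T \<longleftrightarrow> T \<subseteq> E \<and> \<not> graph_connected V (E - T)"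

definition min_edge_cut :: "nat set \<Rightarrow> nat set set \<Rightarrow> nat set set \<Rightarrow> bool" where
  "min_edge_cut V E T \<longleftrightarrow> edge_cut V E T \<and> (\<forall>T'. edge_cut V E T' \<longrightarrow> card T \<le> card T')"

definition unique_min_edge_cut :: "nat set \<Rightarrow> nat set set \<Rightarrow> nat set set \<Rightarrow> bool" where
  "unique_min_edge_cut V E T \<longleftrightarrow> min_edge_cut V E T \<and> (\<forall>T'. min_edge_cut V E T' \<longrightarrow> T' = T)"

section \<open>Drawings\<close>

text \<open>Relative interior of the curve of an edge.\<close>
definition edge_interior :: "(nat set \<Rightarrow> real \<Rightarrow> complex) \<Rightarrow> nat set \<Rightarrow> complex set" where
  "edge_interior c e = c e ` {0<..<1}"

text \<open>Two curves cross transversally at x: near x there is a homeomorphism onto the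
  unit disc sending x to 0, one curve onto the real diameter and the other onto the imaginary one.\<close>
definition crosses_transversally :: "complex set \<Rightarrow> complex set \<Rightarrow> complex \<Rightarrow> bool" where
  "crosses_transversally A B x \<longleftrightarrow>
     (\<exists>U h g. open U \<and> x \<in> U \<and> homeomorphism U (ball 0 1) h g \<and> h x = 0 \<and>
        h ` (U \<inter> A) = {z \<in> ball 0 1. Im z = 0} \<and>
        h ` (U \<inter> B) = {z \<in> ball 0 1. Re z = 0})"

definition drawing ::
  "nat set \<Rightarrow> nat set set \<Rightarrow> (nat \<Rightarrow> complex) \<Rightarrow> (nat set \<Rightarrow> real \<Rightarrow> complex) \<Rightarrow> bool" where
  "drawing V E pos c \<longleftrightarrow>
     inj_on pos V \<and>
     (\<forall>e\<in>E. arc (c e) \<and> {pathstart (c e), pathfinish (c e)} = pos ` e \<and>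
              edge_interior c e \<inter> pos ` V = {}) \<and>
     (\<forall>e\<in>E. \<forall>f\<in>E. \<forall>x. e \<noteq> f \<and> x \<in> edge_interior c e \<inter> edge_interior c f \<longrightarrow>
        (\<forall>g\<in>E. x \<in> edge_interior c g \<longrightarrow> g = e \<or> g = f) \<and>
        crosses_transversally (path_image (c e)) (path_image (c f)) x)"

definition crossings_of :: "nat set set \<Rightarrow> (nat set \<Rightarrow> real \<Rightarrow> complex) \<Rightarrow> nat set \<Rightarrow> complex set" where
  "crossings_of E c e = {x. \<exists>f\<in>E. f \<noteq> e \<and> x \<in> edge_interior c e \<inter> edge_interior c f}"

definition crossings :: "nat set set \<Rightarrow> (nat set \<Rightarrow> real \<Rightarrow> complex) \<Rightarrow> complex set" where
  "crossings E c = (\<Union>e\<in>E. crossings_of E c e)"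

definition k_plane ::
  "nat \<Rightarrow> nat set \<Rightarrow> nat set set \<Rightarrow> (nat \<Rightarrow> complex) \<Rightarrow> (nat set \<Rightarrow> real \<Rightarrow> complex) \<Rightarrow> bool" where
  "k_plane k V E pos c \<longleftrightarrow> drawing V E pos c \<and>
     (\<forall>e\<in>E. finite (crossings_of E c e) \<and> card (crossings_of E c e) \<le> k) \<and>
     (\<forall>e\<in>E. \<forall>f\<in>E. e \<noteq> f \<longrightarrow>
        (\<forall>x y. x \<in> path_image (c e) \<inter> path_image (c f) \<and>
               y \<in> path_image (c e) \<inter> path_image (c f) \<longrightarrow> x = y))"

text \<open>Faces of the drawing (= faces of the planarization): components of the complement
  of the drawn point set.\<close>
definition faces :: "nat set \<Rightarrow> nat set set \<Rightarrow> (nat \<Rightarrow> complex) \<Rightarrow> (nat set \<Rightarrow> real \<Rightarrow> complex) \<Rightarrow> complex set set" where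
  "faces V E pos c = components (- (pos ` V \<union> (\<Union>e\<in>E. path_image (c e))))"

text \<open>Valid placement of the subdivision vertices of \<open>\<tilde>G\<close>: sub t is an interior point of
  the curve of t such that the subarc between it and one of the endpoints contains no crossing.\<close>
definition subdivision_placement ::
  "nat set set \<Rightarrow> (nat set \<Rightarrow> real \<Rightarrow> complex) \<Rightarrow> (nat set \<Rightarrow> complex) \<Rightarrow> bool" where
  "subdivision_placement E c sub \<longleftrightarrow>
     (\<forall>t\<in>E. \<exists>\<tau>\<in>{0<..<1}. sub t = c t \<tau> \<and>
        ((\<forall>\<sigma>\<in>{0..\<tau>}. c t \<sigma> \<notin> crossings E c) \<or> (\<forall>\<sigma>\<in>{\<tau>..1}. c t \<sigma> \<notin> crossings E c)))"

text \<open>Vertices of the planarization of \<open>\<tilde>G\<close>: original vertices, subdivision vertices, crossings.\<close>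
definition tilde_vertices ::
  "nat set \<Rightarrow> nat set set \<Rightarrow> (nat \<Rightarrow> complex) \<Rightarrow> (nat set \<Rightarrow> real \<Rightarrow> complex) \<Rightarrow> (nat set \<Rightarrow> complex) \<Rightarrow> complex set" where
  "tilde_vertices V E pos c sub = pos ` V \<union> sub ` E \<union> crossings E c"

text \<open>A walk in the radial graph with m face-vertices from u to v: alternating
  vertex x_0, face f_0, vertex x_1, ..., face f_{m-1}, vertex x_m, with each x_i, x_{i+1} on the
  boundary of f_i.\<close>
definition radial_walk ::
  "complex set \<Rightarrow> complex set set \<Rightarrow> complex \<Rightarrow> complex \<Rightarrow> nat \<Rightarrow> bool" where
  "radial_walk P F u v m \<longleftrightarrow>
     (\<exists>x :: nat \<Rightarrow> complex. \<exists>fs :: nat \<Rightarrow> complex set.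
        x 0 = u \<and> x m = v \<and> (\<forall>i\<le>m. x i \<in> P) \<and>
        (\<forall>i<m. fs i \<in> F \<and> x i \<in> frontier (fs i) \<and> x (Suc i) \<in> frontier (fs i)))"

text \<open>Face distance (infinite if no path exists).\<close>
definition face_distance ::
  "complex set \<Rightarrow> complex set set \<Rightarrow> complex \<Rightarrow> complex \<Rightarrow> enat" where
  "face_distance P F u v = Inf {enat m | m. radial_walk P F u v m}"

text \<open>d_F in \<open>\<Lambda>(\<tilde>G)\<close>.\<close>
definition dF_tilde ::
  "nat set \<Rightarrow> nat set set \<Rightarrow> (nat \<Rightarrow> complex) \<Rightarrow> (nat set \<Rightarrow> real \<Rightarrow> complex) \<Rightarrow> (nat set \<Rightarrow> complex)
   \<Rightarrow> complex \<Rightarrow> complex \<Rightarrow> enat" where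
  "dF_tilde V E pos c sub u v =
     face_distance (tilde_vertices V E pos c sub) (faces V E pos c) u v"

end

theory Submission
  imports Defs
begin

text \<open>
  Both sides of the cut are chains of cliques on \<open>p + 2\<close> vertices, consecutive ones sharing a single
  vertex. Deleting at most \<open>p\<close> edges disconnects no such clique, hence neither side, so \<open>p\<close>
  additional edges joining the two sides form the unique minimum cut. In any straight-line drawing in
  general position an edge of a clique is crossed only by clique edges joining the two sides of its
  line, that is at most \<open>p\<^sup>2 / 4\<close> times. The first chain is drawn so that its cliques contain nested
  triangles around the origin; the second chain runs outwards along a ray and crosses each triangle
  only in its base, each time with the \<open>p + 1\<close> edges at one vertex. A face lies between two
  consecutive triangles, so cut edges placed \<open>r + 1\<close> levels apart have face-distance at least \<open>r\<close>.
  General position is obtained by choosing the vertices one by one in small boxes; all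
  non-crossings are certified by separating linear functionals that tolerate the perturbation.
\<close>

section \<open>General position\<close>

text \<open>On \<open>p + 1\<close> vertices the star of a clique vertex would be a competing cut of
  size \<open>p\<close>; hence \<open>p + 2\<close>. The hypothesis gives
  \<open>(p + 1)\<^sup>2 \<le> 4 * k\<close>, so \<open>p\<^sup>2 / 4 + 1 \<le> k\<close> once
  \<open>p \<ge> 2\<close>: a clique edge can pay for its own clique and for one further crossing.
  This shapes the picture. Barriers are closed curves made of edges, and the second chain must pass
  through them to reach cut edges on both sides. A passage takes the one spare crossing of each edge
  involved, and all its \<open>p + 1\<close> edges hit the same barrier edge. That edge has to be
  free of other crossings, so it is a hull side of its clique; the remaining estimate is then
  \<open>p + 1 \<le> k\<close>. The factor 16 is room for the boxes: vertices up to level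
  \<open>j\<close> have coordinates at most 61/20 of the scale of \<open>j\<close>, hence lie in a
  square of half-width 4, which is a quarter of the next scale and fits into the next triangle. The
  case \<open>p = 1\<close> is separate, since there are too few vertices for a triangle.\<close>

definition wedge :: "complex \<Rightarrow> complex \<Rightarrow> real" where
  "wedge a b = Re a * Im b - Im a * Re b"

text \<open>Twice the signed area of the triangle: affine in \<open>c\<close>, with the sign telling
  the side of the line through \<open>a\<close> and \<open>b\<close>.\<close>

definition tri :: "complex \<Rightarrow> complex \<Rightarrow> complex \<Rightarrow> real" where
  "tri a b c = wedge (b - a) (c - a)"

lemma tri_swap: "tri b a c = - tri a b c" "tri a c b = - tri a b c"
  by (simp_all add: tri_def wedge_def algebra_simps)

lemma tri_same [simp]: "tri a a b = 0" "tri a b a = 0" "tri a b b = 0"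
  by (simp_all add: tri_def wedge_def)

lemma tri_affine: "tri a b ((1 - s) *\<^sub>R c + s *\<^sub>R d) = (1 - s) * tri a b c + s * tri a b d"
  by (simp add: tri_def wedge_def algebra_simps)

lemma tri_on_segment: "x \<in> closed_segment a b \<Longrightarrow> tri a b x = 0"
  by (auto simp: in_segment tri_affine)

lemma closed_line: "closed {z. tri p q z = 0}"
  unfolding tri_def wedge_def by (intro closed_Collect_eq continuous_intros)

lemma interior_line: assumes "p \<noteq> q" shows "interior {z. tri p q z = 0} = {}"
proof -
  define a where "a = Complex (- Im (q - p)) (Re (q - p))"
  have "a \<noteq> 0" using assms by (auto simp: a_def complex_eq_iff)
  moreover have "{z. tri p q z = 0} = {z. a \<bullet> z = a \<bullet> p}"
    by (auto simp: a_def tri_def wedge_def inner_complex_def algebra_simps)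
  ultimately show ?thesis by (simp add: interior_hyperplane)
qed

lemma interior_finite_Union_closed_empty:
  fixes F :: "'a::topological_space set set"
  assumes "finite F" "\<And>S. S \<in> F \<Longrightarrow> closed S \<and> interior S = {}"
  shows "interior (\<Union>F) = {}"
  using assms
proof (induction F rule: finite_induct)
  case (insert S F)
  then show ?case by (simp add: interior_closed_Un_empty_interior)
qed simp

text \<open>Along the second segment \<open>tri a b\<close> is affine and nonzero at
  \<open>c\<close>, so it has at most one zero, and every common point is a zero.\<close>

lemma segments_meet_once:
  assumes "tri a b c \<noteq> 0" "x \<in> closed_segment a b" "y \<in> closed_segment a b"
    "x \<in> closed_segment c d" "y \<in> closed_segment c d"
  shows "x = y"
proof -
  obtain s where s: "x = (1 - s) *\<^sub>R c + s *\<^sub>R d" using assms by (auto simp: in_segment)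
  obtain t where t: "y = (1 - t) *\<^sub>R c + t *\<^sub>R d" using assms by (auto simp: in_segment)
  define C D where "C = tri a b c" and "D = tri a b d"
  have 0: "(1 - s) * C + s * D = 0" "(1 - t) * C + t * D = 0"
    using assms(2,3) tri_on_segment s t unfolding C_def D_def by (metis tri_affine)+
  then have "(s - t) * C = 0" by algebra
  then show ?thesis using assms(1) s t by (simp add: C_def)
qed

text \<open>Six distinct indices suffice in the concurrency clause, because by the first clause
  crossing edges never share an endpoint (\<open>crossing_disjoint_ends\<close>).\<close>

definition general_position :: "(nat \<Rightarrow> complex) \<Rightarrow> bool" where
  "general_position f \<longleftrightarrow>
     (\<forall>a b c. distinct [a, b, c] \<longrightarrow> tri (f a) (f b) (f c) \<noteq> 0) \<and>
     (\<forall>a b c d e g. distinct [a, b, c, d, e, g] \<longrightarrow>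
        open_segment (f a) (f b) \<inter> open_segment (f c) (f d) \<inter> open_segment (f e) (f g) = {})"

text \<open>Each new point avoids finitely many points and lines, whose union has empty interior.
  Treating crossings of earlier segments as further points turns the ban on triple crossings into a
  collinearity condition.\<close>

lemma general_position_exists:
  fixes U :: "nat \<Rightarrow> complex set"
  assumes U: "\<And>n. open (U n)" "\<And>n. U n \<noteq> {}"
  obtains f where "\<And>n. f n \<in> U n" "general_position f"
proof -
  \<comment> \<open>If the two segments do not meet, \<open>SOME\<close> gives an arbitrary point;
    avoiding it as well is harmless.\<close>
  define X where "X = (\<lambda>f (a,b,c,d). SOME x :: complex.
    x \<in> open_segment (f (a::nat)) (f b) \<inter> open_segment (f c) (f d))"
  define S where "S = (\<lambda>f (n::nat). f ` {..<n} \<union> X f ` ({..<n} \<times> {..<n} \<times> {..<n} \<times> {..<n}))"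
  define P where "P = (\<lambda>f n z. z \<in> U n \<and> z \<notin> S f n \<and>
     (\<forall>p\<in>S f n. \<forall>q\<in>S f n. p \<noteq> q \<longrightarrow> tri p q z \<noteq> 0))"
  have "\<exists>f. \<forall>n. P f n (f n)"
  proof (rule dependent_wellorder_choice)
    fix r :: complex and f g :: "nat \<Rightarrow> complex" and n :: nat
    assume "\<And>y. y < n \<Longrightarrow> f y = g y"
    then have "S f n = S g n"
      unfolding S_def X_def by (intro arg_cong2[where f="(\<union>)"] image_cong) auto
    then show "P f n r = P g n r" by (simp add: P_def)
  next
    fix n and f :: "nat \<Rightarrow> complex"
    have fin: "finite (S f n)" by (simp add: S_def)
    define B where "B = (\<lambda>p. {p}) ` S f n \<union>
      (\<lambda>(p,q). {z. tri p q z = 0}) ` {(p,q) \<in> S f n \<times> S f n. p \<noteq> q}"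
    have "finite B" unfolding B_def using fin by (auto intro: finite_subset[of _ "S f n \<times> S f n"])
    then have "interior (\<Union>B) = {}"
      by (rule interior_finite_Union_closed_empty) (auto simp: B_def closed_line interior_line)
    then have "\<not> U n \<subseteq> \<Union>B" using U interior_maximal by blast
    then obtain z where "z \<in> U n" "z \<notin> \<Union>B" by blast
    then show "\<exists>r. P f n r" by (intro exI[of _ z]) (auto simp: P_def B_def)
  qed
  then obtain f where f: "\<And>n. P f n (f n)" by blast
  have fS: "f a \<in> S f n" if "a < n" for a n using that by (auto simp: S_def)
  have neq: "f a \<noteq> f b" if "a < b" for a b
    using f[of b] fS[OF that] by (auto simp: P_def)
  have neq': "f a \<noteq> f b" if "a \<noteq> b" for a b using that neq by (metis linorder_neqE_nat)
  have t0: "tri (f a) (f b) (f c) \<noteq> 0" if "a < b" "b < c" for a b c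
    using f[of c] fS[of a c] fS[of b c] neq that by (auto simp: P_def)
  have tri: "tri (f a) (f b) (f c) \<noteq> 0" if "distinct [a, b, c]" for a b c
  proof -
    have "a < b \<and> b < c \<or> a < c \<and> c < b \<or> b < a \<and> a < c \<or> b < c \<and> c < a
      \<or> c < a \<and> a < b \<or> c < b \<and> b < a" using that by auto
    then show ?thesis using t0 tri_swap by (metis neg_equal_0_iff_equal)
  qed
  \<comment> \<open>The largest index decides: \<open>f g\<close> was chosen off the line through
    \<open>f e\<close> and the earlier crossing \<open>x\<close>.\<close>
  have key: False
    if d: "distinct [a, b, c, d, e, g]" and lt: "a < g" "b < g" "c < g" "d < g" "e < g"
      and x: "x \<in> open_segment (f a) (f b)" "x \<in> open_segment (f c) (f d)"
        "x \<in> open_segment (f e) (f g)"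
    for a b c d e g x
  proof -
    have "X f (a,b,c,d) \<in> open_segment (f a) (f b) \<inter> open_segment (f c) (f d)"
      unfolding X_def prod.case by (rule someI[of _ x]) (use x in auto)
    then have "X f (a,b,c,d) = x"
      using segments_meet_once[OF tri[of a b c]] d x by (auto simp: open_segment_def)
    moreover have "X f (a,b,c,d) \<in> S f g" using lt by (force simp: S_def)
    ultimately have xS: "x \<in> S f g" by simp
    have "f e \<noteq> x" using x by (auto simp: open_segment_def)
    then have "tri (f e) x (f g) \<noteq> 0" using f[of g] fS[of e g] xS lt by (auto simp: P_def)
    moreover have "tri (f e) (f g) x = 0" using x by (auto simp: open_segment_def tri_on_segment)
    ultimately show False using tri_swap by (metis neg_equal_0_iff_equal)
  qed
  have "open_segment (f a) (f b) \<inter> open_segment (f c) (f d) \<inter> open_segment (f e) (f g) = {}"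
    if d: "distinct [a, b, c, d, e, g]" for a b c d e g
  proof (rule ccontr)
    assume "\<not> ?thesis"
    then obtain x where x: "x \<in> open_segment (f a) (f b)" "x \<in> open_segment (f c) (f d)"
        "x \<in> open_segment (f e) (f g)" by blast
    have x': "x \<in> open_segment (f b) (f a)" "x \<in> open_segment (f d) (f c)"
        "x \<in> open_segment (f g) (f e)" using x by (simp_all add: open_segment_commute)
    define m where "m = Max {a,b,c,d,e,g}"
    have m: "m \<in> {a,b,c,d,e,g}" unfolding m_def by (rule Max_in) auto
    have le: "a \<le> m" "b \<le> m" "c \<le> m" "d \<le> m" "e \<le> m" "g \<le> m" by (auto simp: m_def)
    from m consider "m = a" | "m = b" | "m = c" | "m = d" | "m = e" | "m = g" by blast
    then show False
    proof cases
      case 1 show ?thesis by (rule key[of c d e g b a x]) (use 1 le d x x' in \<open>auto simp: nat_less_le\<close>)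
    next
      case 2 show ?thesis by (rule key[of c d e g a b x]) (use 2 le d x x' in \<open>auto simp: nat_less_le\<close>)
    next
      case 3 show ?thesis by (rule key[of a b e g d c x]) (use 3 le d x x' in \<open>auto simp: nat_less_le\<close>)
    next
      case 4 show ?thesis by (rule key[of a b e g c d x]) (use 4 le d x x' in \<open>auto simp: nat_less_le\<close>)
    next
      case 5 show ?thesis by (rule key[of a b c d g e x]) (use 5 le d x x' in \<open>auto simp: nat_less_le\<close>)
    next
      case 6 show ?thesis by (rule key[of a b c d e g x]) (use 6 le d x x' in \<open>auto simp: nat_less_le\<close>)
    qed
  qed
  then have "general_position f" unfolding general_position_def using tri by blast
  then show ?thesis using that f by (auto simp: P_def)
qed

lemma general_position_inj:
  assumes "general_position f" shows "inj f"
proof (rule injI)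
  fix a b assume eq: "f a = f b"
  show "a = b"
  proof (rule ccontr)
    assume "a \<noteq> b"
    moreover have "Suc (a + b) \<noteq> a" "Suc (a + b) \<noteq> b" by auto
    ultimately have "distinct [a, b, Suc (a + b)]" by simp
    then have "tri (f a) (f b) (f (Suc (a + b))) \<noteq> 0"
      using assms unfolding general_position_def by blast
    then show False using eq by simp
  qed
qed

section \<open>Transversality of crossing segments\<close>

lemma segments_cross_transversally:
  assumes W: "tri a b c \<noteq> tri a b d" and xa: "x \<in> open_segment a b" and xc: "x \<in> open_segment c d"
  shows "crosses_transversally (closed_segment a b) (closed_segment c d) x"
proof -
  obtain s where s: "0 < s" "s < 1" "x = (1 - s) *\<^sub>R a + s *\<^sub>R b" using xa by (auto simp: in_segment)
  obtain t where t: "0 < t" "t < 1" "x = (1 - t) *\<^sub>R c + t *\<^sub>R d" using xc by (auto simp: in_segment)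
  define u v where "u = b - a" and "v = d - c"
  define w where "w = wedge u v"
  have w0: "w \<noteq> 0" using W by (simp add: w_def u_def v_def wedge_def tri_def algebra_simps)
  \<comment> \<open>Shrinking the affine chart by \<open>\<delta>\<close> keeps both diameters of
    the disc inside the segments.\<close>
  define \<delta> where "\<delta> = Min {s, 1 - s, t, 1 - t}"
  have \<delta>: "0 < \<delta>" "\<delta> \<le> s" "\<delta> \<le> 1 - s" "\<delta> \<le> t" "\<delta> \<le> 1 - t"
    using s t by (auto simp: \<delta>_def)
  define g where "g = (\<lambda>z. x + (\<delta> * Re z) *\<^sub>R u + (\<delta> * Im z) *\<^sub>R v)"
  \<comment> \<open>Cramer's rule for inverting \<open>g\<close>, with determinant
    \<open>w\<close>.\<close>
  define h where "h = (\<lambda>z. Complex (wedge (z - x) v / (w * \<delta>)) (wedge u (z - x) / (w * \<delta>)))"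
  have hg: "h (g z) = z" for z
  proof -
    have "wedge (g z - x) v = w * \<delta> * Re z" "wedge u (g z - x) = w * \<delta> * Im z"
      by (simp_all add: g_def w_def wedge_def algebra_simps)
    then show ?thesis using w0 \<delta>(1) by (simp add: h_def complex_eq_iff)
  qed
  have gh: "g (h z) = z" for z
  proof -
    have 1: "wedge (z - x) v * Re u + wedge u (z - x) * Re v = w * (Re z - Re x)"
      and 2: "wedge (z - x) v * Im u + wedge u (z - x) * Im v = w * (Im z - Im x)"
      by (simp_all add: w_def wedge_def algebra_simps)
    have "g (h z) = x + (wedge (z - x) v / w) *\<^sub>R u + (wedge u (z - x) / w) *\<^sub>R v"
      using \<delta>(1) by (simp add: g_def h_def)
    also have "\<dots> = z"
      using 1 2 w0 by (simp add: complex_eq_iff field_simps)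
    finally show ?thesis .
  qed
  have ch: "continuous_on A h" for A
    unfolding h_def wedge_def Complex_eq by (intro continuous_intros) (use w0 \<delta>(1) in auto)
  have cg: "continuous_on A g" for A
    unfolding g_def by (intro continuous_intros)
  define U where "U = h -` ball 0 1"
  have hU: "h ` U = ball 0 1" unfolding U_def using hg by (metis surj_def surj_image_vimage_eq)
  have gU: "g ` ball 0 1 = U" using hU gh hg by (metis (no_types, lifting) image_cong image_ident image_image)
  have "open U" unfolding U_def using ch by (intro open_vimage) (auto simp: continuous_on_eq_continuous_at)
  moreover have hx: "h x = 0" by (simp add: h_def wedge_def complex_eq_iff)
  moreover have "x \<in> U" by (simp add: U_def hx)
  moreover have "homeomorphism U (ball 0 1) h g"
    unfolding homeomorphism_def using hU gU ch cg hg gh by auto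
  moreover have "h ` (U \<inter> closed_segment a b) = {z \<in> ball 0 1. Im z = 0}"
  proof -
    have "Im (h z) = 0" if "z \<in> closed_segment a b" for z
    proof -
      have "wedge u (z - x) = tri a b z - tri a b x"
        by (simp add: u_def tri_def wedge_def algebra_simps)
      also have "\<dots> = 0" using that xa by (simp add: tri_on_segment open_segment_def)
      finally show ?thesis by (simp add: h_def)
    qed
    moreover have "z \<in> h ` (U \<inter> closed_segment a b)" if "z \<in> ball 0 1" "Im z = 0" for z
    proof
      show "z = h (g z)" using hg by simp
      have "\<bar>Re z\<bar> < 1" using that abs_Re_le_cmod[of z] by simp
      then have "\<bar>\<delta> * Re z\<bar> \<le> \<delta>" using \<delta>(1) by (simp add: abs_mult)
      then have "0 \<le> s + \<delta> * Re z" "s + \<delta> * Re z \<le> 1" using \<delta> by linarith+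
      moreover have "g z = (1 - (s + \<delta> * Re z)) *\<^sub>R a + (s + \<delta> * Re z) *\<^sub>R b"
        using that s by (simp add: g_def u_def algebra_simps)
      ultimately have "g z \<in> closed_segment a b" unfolding in_segment by blast
      then show "g z \<in> U \<inter> closed_segment a b" using that hg by (simp add: U_def)
    qed
    ultimately show ?thesis using hU by blast
  qed
  moreover have "h ` (U \<inter> closed_segment c d) = {z \<in> ball 0 1. Re z = 0}"
  proof -
    have "Re (h z) = 0" if "z \<in> closed_segment c d" for z
    proof -
      have "wedge (z - x) v = tri c d x - tri c d z"
        by (simp add: v_def tri_def wedge_def algebra_simps)
      also have "\<dots> = 0" using that xc by (simp add: tri_on_segment open_segment_def)
      finally show ?thesis by (simp add: h_def)
    qed
    moreover have "z \<in> h ` (U \<inter> closed_segment c d)" if "z \<in> ball 0 1" "Re z = 0" for z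
    proof
      show "z = h (g z)" using hg by simp
      have "\<bar>Im z\<bar> < 1" using that abs_Im_le_cmod[of z] by simp
      then have "\<bar>\<delta> * Im z\<bar> \<le> \<delta>" using \<delta>(1) by (simp add: abs_mult)
      then have "0 \<le> t + \<delta> * Im z" "t + \<delta> * Im z \<le> 1" using \<delta> by linarith+
      moreover have "g z = (1 - (t + \<delta> * Im z)) *\<^sub>R c + (t + \<delta> * Im z) *\<^sub>R d"
        using that t by (simp add: g_def v_def algebra_simps)
      ultimately have "g z \<in> closed_segment c d" unfolding in_segment by blast
      then show "g z \<in> U \<inter> closed_segment c d" using that hg by (simp add: U_def)
    qed
    ultimately show ?thesis using hU by blast
  qed
  ultimately show ?thesis unfolding crosses_transversally_def by blast
qed

section \<open>Straight-line drawings\<close>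

definition straight :: "(nat \<Rightarrow> complex) \<Rightarrow> nat set \<Rightarrow> real \<Rightarrow> complex" where
  "straight f e = linepath (f (Min e)) (f (Max e))"

lemma edge_interior_straight:
  assumes "inj f" "a \<noteq> b"
  shows "edge_interior (straight f) {a, b} = open_segment (f a) (f b)"
proof -
  have *: "linepath u v ` {0<..<1} = open_segment u v" if "u \<noteq> v" for u v :: complex
    using that by (auto simp: linepath_def in_segment image_iff intro!: bexI)
  have "f a \<noteq> f b" using assms by (simp add: inj_eq)
  then show ?thesis
    using * by (cases "a < b") (auto simp: edge_interior_def straight_def min_def max_def open_segment_commute)
qed

lemma path_image_straight: "path_image (straight f {a, b}) = closed_segment (f a) (f b)"
  by (auto simp: straight_def min_def max_def closed_segment_commute)

definition crossing_edges :: "nat set set \<Rightarrow> (nat \<Rightarrow> complex) \<Rightarrow> nat set \<Rightarrow> nat set set" where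
  "crossing_edges E f e = {g \<in> E. g \<noteq> e \<and>
     edge_interior (straight f) e \<inter> edge_interior (straight f) g \<noteq> {}}"

lemma simple_graph_edge:
  assumes "simple_graph V E" "e \<in> E"
  obtains a b where "e = {a, b}" "a \<noteq> b" "a \<in> V" "b \<in> V"
  using assms unfolding simple_graph_def by (metis card_2_iff insert_subset)

lemma finite_edges: "simple_graph V E \<Longrightarrow> finite E"
  unfolding simple_graph_def by (rule finite_subset[of E "Pow V"]) auto

definition clique :: "nat set \<Rightarrow> nat set set" where
  "clique K = {e. e \<subseteq> K \<and> card e = 2}"

context
  fixes f :: "nat \<Rightarrow> complex"
  assumes gp: "general_position f"
begin

lemma gp_tri: "\<lbrakk>a \<noteq> b; a \<noteq> c; b \<noteq> c\<rbrakk> \<Longrightarrow> tri (f a) (f b) (f c) \<noteq> 0"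
  using gp unfolding general_position_def by simp

lemma gp_concurrent:
  "\<lbrakk>distinct [a, b, c, d, e, g]; x \<in> open_segment (f a) (f b); x \<in> open_segment (f c) (f d);
    x \<in> open_segment (f e) (f g)\<rbrakk> \<Longrightarrow> False"
  using gp unfolding general_position_def by blast

text \<open>The affine function \<open>tri (f a) (f b)\<close> vanishes strictly between
  \<open>f c\<close> and \<open>f d\<close>, so its end values have opposite signs or are both zero;
  the latter would force \<open>{c, d} = {a, b}\<close>. Strictness also rules out shared
  endpoints.\<close>

lemma crossing_opposite_sides:
  assumes "{a, b} \<noteq> {c, d}" "a \<noteq> b" "c \<noteq> d"
    "x \<in> open_segment (f a) (f b)" "x \<in> open_segment (f c) (f d)"
  shows "tri (f a) (f b) (f c) * tri (f a) (f b) (f d) < 0"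
proof -
  define C D where "C = tri (f a) (f b) (f c)" and "D = tri (f a) (f b) (f d)"
  obtain s where s: "0 < s" "s < 1" "x = (1 - s) *\<^sub>R f c + s *\<^sub>R f d"
    using assms(5) by (auto simp: in_segment)
  have "tri (f a) (f b) x = 0" using assms(4) by (simp add: tri_on_segment open_segment_def)
  then have eq: "(1 - s) * C + s * D = 0" by (simp add: s(3) tri_affine C_def D_def)
  have "C \<noteq> 0 \<or> D \<noteq> 0"
  proof (rule ccontr)
    assume "\<not> ?thesis"
    then have "c \<in> {a, b}" "d \<in> {a, b}" using gp_tri[OF assms(2), of c] gp_tri[OF assms(2), of d] by (auto simp: C_def D_def)
    then show False using assms(1,3) by (auto simp: doubleton_eq_iff)
  qed
  moreover have "D = 0" if "C = 0" using eq that s(1) by simp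
  ultimately have "C \<noteq> 0" by blast
  have "s * D = - ((1 - s) * C)" using eq by linarith
  then have "C * (s * D) = C * - ((1 - s) * C)" by simp
  then have "s * (C * D) = - ((1 - s) * C\<^sup>2)" by (simp only: power2_eq_square mult_minus_right ac_simps)
  also have "\<dots> < 0" using s(2) \<open>C \<noteq> 0\<close> by simp
  finally have "C * D < 0" using s(1) zero_less_mult_pos[of s "- (C * D)"] by simp
  then show ?thesis by (simp add: C_def D_def)
qed

lemma crossing_disjoint_ends:
  assumes "{a, b} \<noteq> {c, d}" "a \<noteq> b" "c \<noteq> d"
    "x \<in> open_segment (f a) (f b)" "x \<in> open_segment (f c) (f d)"
  shows "distinct [a, b, c, d]"
  using crossing_opposite_sides[OF assms] assms(2,3) by auto

text \<open>Closed segments are used to cover adjacent edges too: some endpoint of the second edge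
  is not an endpoint of the first, hence lies off its line.\<close>

lemma edges_meet_once:
  assumes "{a, b} \<noteq> {c, d}" "a \<noteq> b" "c \<noteq> d"
    "x \<in> closed_segment (f a) (f b)" "y \<in> closed_segment (f a) (f b)"
    "x \<in> closed_segment (f c) (f d)" "y \<in> closed_segment (f c) (f d)"
  shows "x = y"
proof -
  have "c \<notin> {a, b} \<or> d \<notin> {a, b}" using assms(1-3) by auto
  then consider "a \<noteq> c" "b \<noteq> c" | "a \<noteq> d" "b \<noteq> d" by auto
  then show ?thesis
  proof cases
    case 1
    show ?thesis by (rule segments_meet_once[OF gp_tri[OF assms(2) 1] assms(4-7)])
  next
    case 2
    show ?thesis
      using segments_meet_once[OF gp_tri[OF assms(2) 2] assms(4,5)] assms(6,7)
      by (metis closed_segment_commute)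
  qed
qed

lemma straight_drawing:
  assumes sg: "simple_graph V E"
  shows "drawing V E f (straight f)"
  unfolding drawing_def
proof (intro conjI ballI allI impI)
  have inj: "inj f" by (rule general_position_inj[OF gp])
  then show "inj_on f V" by (meson inj_on_subset subset_UNIV)
  fix e assume e: "e \<in> E"
  obtain a b where ab: "e = {a, b}" "a \<noteq> b" using simple_graph_edge[OF sg e] by blast
  have fab: "f a \<noteq> f b" using ab inj by (simp add: inj_eq)
  show "arc (straight f e)" using ab fab by (auto simp: straight_def min_def max_def)
  show "{pathstart (straight f e), pathfinish (straight f e)} = f ` e"
    using ab by (auto simp: straight_def min_def max_def)
  have "f c \<notin> open_segment (f a) (f b)" for c
    using gp_tri[OF ab(2), of c] tri_on_segment[of "f c" "f a" "f b"] by (auto simp: open_segment_def)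
  then show "edge_interior (straight f) e \<inter> f ` V = {}"
    using ab inj by (auto simp: edge_interior_straight)
  fix g x assume g: "g \<in> E" and "e \<noteq> g \<and> x \<in> edge_interior (straight f) e \<inter> edge_interior (straight f) g"
  then have eg: "e \<noteq> g" and x: "x \<in> edge_interior (straight f) e" "x \<in> edge_interior (straight f) g" by auto
  obtain c d where cd: "g = {c, d}" "c \<noteq> d" using simple_graph_edge[OF sg g] by blast
  have x1: "x \<in> open_segment (f a) (f b)" "x \<in> open_segment (f c) (f d)"
    using x ab cd inj by (simp_all add: edge_interior_straight)
  have ne: "{a, b} \<noteq> {c, d}" using eg ab cd by simp
  have "tri (f a) (f b) (f c) * tri (f a) (f b) (f d) < 0"
    by (rule crossing_opposite_sides[OF ne ab(2) cd(2) x1])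
  then have "tri (f a) (f b) (f c) \<noteq> tri (f a) (f b) (f d)"
    using not_square_less_zero by metis
  then show "crosses_transversally (path_image (straight f e)) (path_image (straight f g)) x"
    using segments_cross_transversally x1 ab(1) cd(1) by (simp add: path_image_straight)
  fix g' assume g': "g' \<in> E" and x': "x \<in> edge_interior (straight f) g'"
  obtain c' d' where cd': "g' = {c', d'}" "c' \<noteq> d'" using simple_graph_edge[OF sg g'] by blast
  have x2: "x \<in> open_segment (f c') (f d')"
    using x' cd' inj by (simp add: edge_interior_straight)
  show "g' = e \<or> g' = g"
  proof (rule ccontr)
    assume "\<not> ?thesis"
    then have ne': "{a, b} \<noteq> {c', d'}" "{c, d} \<noteq> {c', d'}" using ab cd cd' by auto
    have "distinct [a, b, c, d]" by (rule crossing_disjoint_ends[OF ne ab(2) cd(2) x1])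
    moreover have "distinct [a, b, c', d']"
      by (rule crossing_disjoint_ends[OF ne'(1) ab(2) cd'(2) x1(1) x2])
    moreover have "distinct [c, d, c', d']"
      by (rule crossing_disjoint_ends[OF ne'(2) cd(2) cd'(2) x1(2) x2])
    ultimately have "distinct [a, b, c, d, c', d']" by auto
    then show False by (rule gp_concurrent[OF _ x1 x2])
  qed
qed

text \<open>Since two edges meet at most once, crossing points may be counted by crossing partners,
  which makes the bound combinatorial.\<close>

lemma straight_k_plane:
  assumes sg: "simple_graph V E" and k: "\<And>e. e \<in> E \<Longrightarrow> card (crossing_edges E f e) \<le> k"
  shows "k_plane k V E f (straight f)"
  unfolding k_plane_def
proof (intro conjI ballI allI impI)
  show "drawing V E f (straight f)" by (rule straight_drawing[OF sg])
  have inj: "inj f" by (rule general_position_inj[OF gp])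
  have once: "x = y" if eg: "e \<in> E" "g \<in> E" "e \<noteq> g"
    "x \<in> path_image (straight f e) \<inter> path_image (straight f g) \<and>
     y \<in> path_image (straight f e) \<inter> path_image (straight f g)" for e g x y
  proof -
    obtain a b where ab: "e = {a, b}" "a \<noteq> b" using simple_graph_edge[OF sg eg(1)] by blast
    obtain c d where cd: "g = {c, d}" "c \<noteq> d" using simple_graph_edge[OF sg eg(2)] by blast
    show ?thesis using edges_meet_once[of a b c d x y] eg ab cd by (simp add: path_image_straight)
  qed
  then show "x = y" if "e \<in> E" "g \<in> E" "e \<noteq> g"
    "x \<in> path_image (straight f e) \<inter> path_image (straight f g) \<and>
     y \<in> path_image (straight f e) \<inter> path_image (straight f g)" for e g x y using that .
  fix e assume e: "e \<in> E"
  have sub: "edge_interior (straight f) g \<subseteq> path_image (straight f g)" for g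
    by (auto simp: edge_interior_def path_image_def)
  define X where "X = (\<lambda>g. SOME x. x \<in> edge_interior (straight f) e \<inter> edge_interior (straight f) g)"
  have fin: "finite (crossing_edges E f e)"
    using finite_edges[OF sg] by (simp add: crossing_edges_def)
  have "crossings_of E (straight f) e \<subseteq> X ` crossing_edges E f e"
  proof
    fix x assume "x \<in> crossings_of E (straight f) e"
    then obtain g where g: "g \<in> E" "g \<noteq> e" "x \<in> edge_interior (straight f) e \<inter> edge_interior (straight f) g"
      by (auto simp: crossings_of_def)
    then have "X g \<in> edge_interior (straight f) e \<inter> edge_interior (straight f) g"
      unfolding X_def by (metis someI_ex)
    then have "x = X g" using once[OF e g(1), of x "X g"] g sub by blast
    moreover have "g \<in> crossing_edges E f e" using g by (auto simp: crossing_edges_def)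
    ultimately show "x \<in> X ` crossing_edges E f e" by blast
  qed
  note * = this
  show "finite (crossings_of E (straight f) e)" by (rule finite_subset[OF * finite_imageI[OF fin]])
  have "card (crossings_of E (straight f) e) \<le> card (crossing_edges E f e)"
    by (rule surj_card_le[OF fin *])
  then show "card (crossings_of E (straight f) e) \<le> k" using k[OF e] by linarith
qed

text \<open>The line of \<open>e\<close> splits the other \<open>p\<close> vertices into
  \<open>P\<close> and \<open>M\<close>, and each crossing edge joins the two sides. The bound is
  then the inequality of arithmetic and geometric means, multiplied by 4 to stay within the
  naturals.\<close>

lemma clique_crossings:
  assumes K: "finite K" "card K = p + 2" and e: "e \<in> clique K"
  shows "4 * card (crossing_edges (clique K) f e) \<le> p\<^sup>2"
proof -
  obtain a b where ab: "e = {a, b}" "a \<noteq> b" "a \<in> K" "b \<in> K"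
    using e by (auto simp: clique_def card_2_iff)
  define P M where "P = {c \<in> K. tri (f a) (f b) (f c) > 0}" and "M = {c \<in> K. tri (f a) (f b) (f c) < 0}"
  have fin: "finite P" "finite M" using K by (auto simp: P_def M_def)
  have "crossing_edges (clique K) f e \<subseteq> (\<lambda>(c,d). {c,d}) ` (P \<times> M)"
  proof
    fix g assume "g \<in> crossing_edges (clique K) f e"
    then obtain x where g: "g \<in> clique K" "g \<noteq> e" and x: "x \<in> edge_interior (straight f) e"
       "x \<in> edge_interior (straight f) g" by (auto simp: crossing_edges_def)
    obtain c d where cd: "g = {c, d}" "c \<noteq> d" "c \<in> K" "d \<in> K"
      using g by (auto simp: clique_def card_2_iff)
    have "tri (f a) (f b) (f c) * tri (f a) (f b) (f d) < 0"
      using crossing_opposite_sides[of a b c d x] ab cd g x general_position_inj[OF gp]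
      by (auto simp: edge_interior_straight)
    then have "c \<in> P \<and> d \<in> M \<or> d \<in> P \<and> c \<in> M" using cd by (auto simp: P_def M_def mult_less_0_iff)
    then show "g \<in> (\<lambda>(c,d). {c,d}) ` (P \<times> M)" using cd by (auto simp: insert_commute)
  qed
  then have "card (crossing_edges (clique K) f e) \<le> card (P \<times> M)"
    by (rule surj_card_le[rotated]) (use fin in simp)
  also have "\<dots> = card P * card M" by (rule card_cartesian_product)
  finally have 1: "card (crossing_edges (clique K) f e) \<le> card P * card M" .
  have "card P + card M = card (P \<union> M)"
    using fin by (subst card_Un_disjoint) (auto simp: P_def M_def)
  also have "\<dots> \<le> card (K - {a, b})" using K by (intro card_mono) (auto simp: P_def M_def)
  also have "\<dots> = p" using K ab by (simp add: card_Diff_subset)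
  finally have "(card P + card M)\<^sup>2 \<le> p\<^sup>2" by simp
  moreover have "4 * (card P * card M) \<le> (card P + card M)\<^sup>2"
  proof -
    have "0 \<le> (int (card P) - int (card M))\<^sup>2" by simp
    then have "int (4 * (card P * card M)) \<le> int ((card P + card M)\<^sup>2)"
      by (simp add: power2_eq_square algebra_simps)
    then show ?thesis by linarith
  qed
  ultimately show ?thesis using 1 by linarith
qed

end

section \<open>Tools: separating functionals, robust cliques, triangles, radial walks\<close>

lemma open_segments_separated:
  fixes \<phi> :: "complex \<Rightarrow> real"
  assumes "linear \<phi>" "\<phi> a \<le> \<gamma>" "\<phi> b \<le> \<gamma>" "\<gamma> \<le> \<phi> c" "\<gamma> \<le> \<phi> d"
    "\<phi> a < \<gamma> \<or> \<phi> b < \<gamma> \<or> \<gamma> < \<phi> c \<or> \<gamma> < \<phi> d"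
  shows "open_segment a b \<inter> open_segment c d = {}"
proof (rule ccontr)
  assume "\<not> ?thesis"
  then obtain x where "x \<in> open_segment a b" "x \<in> open_segment c d" by blast
  then obtain s t where s: "0 < s" "s < 1" "x = (1 - s) *\<^sub>R a + s *\<^sub>R b"
    and t: "0 < t" "t < 1" "x = (1 - t) *\<^sub>R c + t *\<^sub>R d" by (auto simp: in_segment)
  have 1: "\<phi> x = (1 - s) * \<phi> a + s * \<phi> b" using assms(1) s by (simp add: linear_add linear_scale)
  have 2: "\<phi> x = (1 - t) * \<phi> c + t * \<phi> d" using assms(1) t by (simp add: linear_add linear_scale)
  \<comment> \<open>The four weighted slacks are nonnegative with sum zero, so all vanish, although
    every endpoint has positive weight. One strict endpoint is therefore enough, and edges may touch
    at a vertex on the separating line.\<close>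
  define A B C D where "A = (1 - s) * (\<gamma> - \<phi> a)" and "B = s * (\<gamma> - \<phi> b)"
    and "C = (1 - t) * (\<phi> c - \<gamma>)" and "D = t * (\<phi> d - \<gamma>)"
  have "A + B + C + D = 0" using 1 2 by (simp add: A_def B_def C_def D_def algebra_simps)
  moreover have "A \<ge> 0" "B \<ge> 0" "C \<ge> 0" "D \<ge> 0"
    using assms s t by (auto simp: A_def B_def C_def D_def)
  ultimately have "A = 0" "B = 0" "C = 0" "D = 0" by linarith+
  then show False using assms(6) s t by (simp add: A_def B_def C_def D_def)
qed

text \<open>Separating \<open>u\<close> from \<open>v\<close> requires deleting the edge between
  them and, for every other \<open>w\<close>, one edge of the path through \<open>w\<close>. The map
  \<open>h\<close> picks these \<open>p + 1\<close> distinct edges.\<close>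

lemma clique_robust:
  assumes K: "finite K" "card K = p + 2" and E: "clique K \<subseteq> E" and T: "finite T" "card T \<le> p"
    and uv: "u \<in> K" "v \<in> K"
  shows "(u, v) \<in> {(x, y). {x, y} \<in> E - T}\<^sup>*" (is "_ \<in> ?R\<^sup>*")
proof (rule ccontr)
  assume no: "(u, v) \<notin> ?R\<^sup>*"
  then have ne: "u \<noteq> v" by auto
  have inE: "{a, b} \<in> E" if "a \<in> K" "b \<in> K" "a \<noteq> b" for a b
    using that E by (auto simp: clique_def)
  define h where "h = (\<lambda>w. if {u, w} \<in> T then {u, w} else {v, w})"
  have uvT: "{u, v} \<in> T" using no inE[OF uv ne] by blast
  have "h ` (K - {u}) \<subseteq> T"
  proof
    fix g assume "g \<in> h ` (K - {u})"
    then obtain w where w: "w \<in> K" "w \<noteq> u" "g = h w" by blast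
    show "g \<in> T"
    proof (rule ccontr)
      assume "g \<notin> T"
      then have "{u, w} \<notin> T" "{v, w} \<notin> T" using w by (auto simp: h_def split: if_splits)
      moreover have "w \<noteq> v" using calculation uvT by auto
      ultimately have "(u, w) \<in> ?R" "(w, v) \<in> ?R" using inE w uv by (auto simp: insert_commute)
      then show False using no by (meson converse_rtrancl_into_rtrancl r_into_rtrancl)
    qed
  qed
  moreover have "inj_on h (K - {u})"
    using uvT ne by (auto simp: inj_on_def h_def doubleton_eq_iff split: if_splits)
  ultimately have "card (K - {u}) \<le> card T" using T by (metis card_image card_mono)
  then show False using K uv T by simp
qed

text \<open>The three values are unnormalised barycentric coordinates; where all are positive they
  describe an open subset of the hull.\<close>

lemma in_interior_triangle:
  assumes "tri a b z > 0" "tri b c z > 0" "tri c a z > 0"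
  shows "z \<in> interior (convex hull {a, b, c})"
proof -
  define S where "S = {z. tri a b z > 0} \<inter> {z. tri b c z > 0} \<inter> {z. tri c a z > 0}"
  have "open S"
    unfolding S_def tri_def wedge_def by (intro open_Int open_Collect_less continuous_intros)
  moreover have "S \<subseteq> convex hull {a, b, c}"
  proof
    fix x assume "x \<in> S"
    define A B C W where "A = tri b c x" and "B = tri c a x" and "C = tri a b x" and "W = tri a b c"
    have pos: "A > 0" "B > 0" "C > 0" using \<open>x \<in> S\<close> by (auto simp: S_def A_def B_def C_def)
    have W: "W = A + B + C"
      by (simp add: A_def B_def C_def W_def tri_def wedge_def algebra_simps)
    have "W * Re x = A * Re a + B * Re b + C * Re c" "W * Im x = A * Im a + B * Im b + C * Im c"
      by (simp_all add: A_def B_def C_def W_def tri_def wedge_def algebra_simps)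
    moreover have "W \<noteq> 0" using W pos by simp
    ultimately have "Re x = (A * Re a + B * Re b + C * Re c) / W" "Im x = (A * Im a + B * Im b + C * Im c) / W"
      by (simp_all add: eq_divide_eq mult.commute)
    then have "x = (A / W) *\<^sub>R a + (B / W) *\<^sub>R b + (C / W) *\<^sub>R c"
      by (simp add: complex_eq_iff add_divide_distrib)
    moreover have "A / W + B / W + C / W = 1" using W pos by (simp add: add_divide_distrib[symmetric])
    moreover have "A / W \<ge> 0" "B / W \<ge> 0" "C / W \<ge> 0" using W pos by auto
    ultimately show "x \<in> convex hull {a, b, c}" unfolding convex_hull_3 by blast
  qed
  moreover have "z \<in> S" using assms by (simp add: S_def)
  ultimately show ?thesis using interior_maximal by blast
qed

lemma radial_walk_sym: "radial_walk P F u v m \<Longrightarrow> radial_walk P F v u m"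
proof -
  assume "radial_walk P F u v m"
  then obtain x fs where x: "x 0 = u" "x m = v" "\<forall>i\<le>m. x i \<in> P"
    "\<forall>i<m. fs i \<in> F \<and> x i \<in> frontier (fs i) \<and> x (Suc i) \<in> frontier (fs i)"
    unfolding radial_walk_def by blast
  have "fs (m - Suc i) \<in> F \<and> x (m - i) \<in> frontier (fs (m - Suc i)) \<and> x (m - Suc i) \<in> frontier (fs (m - Suc i))"
    if "i < m" for i
  proof -
    have "m - Suc i < m" "Suc (m - Suc i) = m - i" using that by auto
    then show ?thesis using x(4) by metis
  qed
  then show ?thesis unfolding radial_walk_def
    by (intro exI[of _ "\<lambda>i. x (m - i)"] exI[of _ "\<lambda>i. fs (m - Suc i)"]) (use x in auto)
qed

text \<open>Every face lies between two consecutive barriers, so a radial walk crosses at most one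
  barrier per face-vertex.\<close>
lemma radial_walk_nested:
  fixes D :: "nat \<Rightarrow> complex set"
  assumes walk: "radial_walk P F u v m"
    and F: "\<And>g. g \<in> F \<Longrightarrow> connected g"
    and fr: "\<And>g j. \<lbrakk>g \<in> F; l < j; j \<le> h\<rbrakk> \<Longrightarrow> g \<inter> frontier (D j) = {}"
    and cl: "\<And>j. closed (D j)"
    and nest: "\<And>i j. \<lbrakk>l \<le> i; i < j; j \<le> h\<rbrakk> \<Longrightarrow> D i \<subseteq> interior (D j)"
    and u: "u \<in> D l" and v: "v \<notin> interior (D h)"
  shows "h \<le> l + m"
proof (rule ccontr)
  assume "\<not> ?thesis"
  then have lt: "l + m < h" by simp
  obtain x fs where x: "x 0 = u" "x m = v"
    "\<forall>i<m. fs i \<in> F \<and> x i \<in> frontier (fs i) \<and> x (Suc i) \<in> frontier (fs i)"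
    using walk unfolding radial_walk_def by blast
  have "x i \<in> D (l + i)" if "i \<le> m" for i
    using that
  proof (induction i)
    case 0
    then show ?case using x u by simp
  next
    case (Suc i)
    then have i: "i < m" and xi: "x i \<in> D (l + i)" by auto
    let ?g = "fs i" and ?D = "D (l + Suc i)"
    have g: "?g \<in> F" "x i \<in> closure ?g" "x (Suc i) \<in> closure ?g"
      using x(3) i by (auto simp: frontier_def)
    \<comment> \<open>The vertex may lie on the frontier of \<open>D (l + i)\<close>, but it is
      interior to the next set. So the face touching it meets that set and, avoiding its frontier,
      stays inside.\<close>
    have "x i \<in> interior ?D" using nest[of "l + i" "l + Suc i"] xi i lt by auto
    then have "interior ?D \<inter> ?g \<noteq> {}"
      using g(2) by (meson disjoint_iff open_Int_closure_eq_empty open_interior)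
    then have "?g \<inter> ?D \<noteq> {}" using interior_subset by blast
    moreover have "?g \<inter> frontier ?D = {}" using fr[OF g(1), of "l + Suc i"] i lt by simp
    ultimately have "?g \<subseteq> ?D" using connected_Int_frontier[OF F[OF g(1)]] by blast
    then show ?case using g(3) cl closure_minimal by blast
  qed
  then have "v \<in> D (l + m)" using x(2) by blast
  then show False using nest[of "l + m" h] lt v by auto
qed

section \<open>The graph and its position bounds\<close>

text \<open>Level \<open>j\<close> of the picture lives at scale \<open>16 ^ j\<close>. Up to an error of \<open>1/20\<close> of the scale,
  \<open>vA j 0\<close>, \<open>vA j 1\<close>, \<open>vA j 2\<close> are the apex, left and right corner of a triangle around the origin,
  the other \<open>vA j i\<close> lie below the apex, and the \<open>vB j i\<close> lie on the negative imaginary axis, below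
  the triangle of level \<open>j\<close> and above the base of the next one.\<close>

definition vA :: "nat \<Rightarrow> nat \<Rightarrow> nat" where "vA j i = prod_encode (0, prod_encode (j, i))"
definition vB :: "nat \<Rightarrow> nat \<Rightarrow> nat" where "vB j i = prod_encode (1, prod_encode (j, i))"

lemma vertex_eq [simp]:
  "vA j i = vA j' i' \<longleftrightarrow> j = j' \<and> i = i'" "vB j i = vB j' i' \<longleftrightarrow> j = j' \<and> i = i'"
  "vA j i \<noteq> vB j' i'" "vB j i \<noteq> vA j' i'"
  by (auto simp: vA_def vB_def)

text \<open>Index 0 is the hinge between consecutive cliques: the apex is the highest point of its
  level, \<open>vB j 0\<close> the lowest one of its level. Except for bases, lines through the
  hinge can then separate the cliques that it joins.\<close>

definition centre :: "nat \<Rightarrow> nat \<Rightarrow> complex" where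
  "centre s i = (if s = 0
     then (if i = 0 then Complex 0 1 else if i = 1 then Complex (-1) (-1)
           else if i = 2 then Complex 1 (-1) else Complex 0 (3/5))
     else (if i = 0 then Complex 0 (-3) else Complex 0 (-2)))"

definition box :: "nat \<Rightarrow> complex set" where
  "box n = (case prod_decode n of (s, m) \<Rightarrow> case prod_decode m of (j, i) \<Rightarrow>
     {z. \<bar>Re z - 16 ^ j * Re (centre s i)\<bar> < 16 ^ j / 20} \<inter>
     {z. \<bar>Im z - 16 ^ j * Im (centre s i)\<bar> < 16 ^ j / 20})"

lemma open_box: "open (box n)"
  unfolding box_def by (auto split: prod.split intro!: open_Int open_Collect_less continuous_intros)

lemma box_nonempty: "box n \<noteq> {}"
proof -
  obtain s j i where "n = prod_encode (s, prod_encode (j, i))"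
    by (metis prod_decode_inverse surj_pair)
  then have "16 ^ j *\<^sub>R centre s i \<in> box n" by (simp add: box_def)
  then show ?thesis by blast
qed

text \<open>Consecutive cliques share exactly one vertex, which suffices for edge-connectivity.\<close>

definition KA :: "nat \<Rightarrow> nat \<Rightarrow> nat set" where "KA p j = insert (vA j 0) (vA (Suc j) ` {..p})"
definition KB :: "nat \<Rightarrow> nat \<Rightarrow> nat set" where "KB p j = insert (vB j 0) (vB (Suc j) ` {..p})"
text \<open>Indexed by its clique: it is the bottom side of the triangle of level
  \<open>j + 1\<close>.\<close>

definition base :: "nat \<Rightarrow> nat set" where "base j = {vA (Suc j) 1, vA (Suc j) 2}"
text \<open>Leaves the triangle of level \<open>m\<close> at its left corner and ends at a hinge
  still inside the triangle of level \<open>m + 1\<close>.\<close>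

definition cut_edge :: "nat \<Rightarrow> nat set" where "cut_edge m = {vA m 1, vB m 0}"

lemma finite_K [simp]: "finite (KA p j)" "finite (KB p j)"
  by (simp_all add: KA_def KB_def)

lemma card_K: "card (KA p j) = p + 2" "card (KB p j) = p + 2"
proof -
  have "inj_on (vA (Suc j)) {..p}" "inj_on (vB (Suc j)) {..p}" by (auto simp: inj_on_def)
  then show "card (KA p j) = p + 2" "card (KB p j) = p + 2"
    by (auto simp: KA_def KB_def card_insert_if card_image)
qed

lemma clique_card: "e \<in> clique K \<Longrightarrow> card e = 2"
  by (simp add: clique_def)

lemma card_cut_edge: "card (cut_edge m) = 2"
  by (simp add: cut_edge_def)

locale placed =
  fixes p :: nat and f :: "nat \<Rightarrow> complex"
  assumes p2: "p \<ge> 2" and gp: "general_position f" and in_box: "\<And>n. f n \<in> box n"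
begin

section \<open>Coordinate bounds and separating lines\<close>

definition L :: "nat \<Rightarrow> real" where "L j = 16 ^ j"

lemma L_pos: "L j > 0" and L_Suc: "L (Suc j) = 16 * L j"
  by (simp_all add: L_def)

lemma L_mono: "i \<le> j \<Longrightarrow> L i \<le> L j"
  by (simp add: L_def)

lemma L_less: "i < j \<Longrightarrow> 16 * L i \<le> L j"
  using L_mono[of "Suc i" j] L_Suc by simp

lemma posA: "20 * (L j * Re (centre 0 i)) - L j < 20 * Re (f (vA j i))"
    "20 * Re (f (vA j i)) < 20 * (L j * Re (centre 0 i)) + L j"
    "20 * (L j * Im (centre 0 i)) - L j < 20 * Im (f (vA j i))"
    "20 * Im (f (vA j i)) < 20 * (L j * Im (centre 0 i)) + L j"
proof -
  have "\<bar>Re (f (vA j i)) - L j * Re (centre 0 i)\<bar> < L j / 20" "\<bar>Im (f (vA j i)) - L j * Im (centre 0 i)\<bar> < L j / 20"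
    using in_box[of "vA j i"] by (simp_all add: box_def vA_def L_def)
  then show "20 * (L j * Re (centre 0 i)) - L j < 20 * Re (f (vA j i))"
    "20 * Re (f (vA j i)) < 20 * (L j * Re (centre 0 i)) + L j"
    "20 * (L j * Im (centre 0 i)) - L j < 20 * Im (f (vA j i))"
    "20 * Im (f (vA j i)) < 20 * (L j * Im (centre 0 i)) + L j" by linarith+
qed

lemma posB: "20 * (L j * Re (centre 1 i)) - L j < 20 * Re (f (vB j i))"
    "20 * Re (f (vB j i)) < 20 * (L j * Re (centre 1 i)) + L j"
    "20 * (L j * Im (centre 1 i)) - L j < 20 * Im (f (vB j i))"
    "20 * Im (f (vB j i)) < 20 * (L j * Im (centre 1 i)) + L j"
proof -
  have "\<bar>Re (f (vB j i)) - L j * Re (centre 1 i)\<bar> < L j / 20" "\<bar>Im (f (vB j i)) - L j * Im (centre 1 i)\<bar> < L j / 20"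
    using in_box[of "vB j i"] by (simp_all add: box_def vB_def L_def)
  then show "20 * (L j * Re (centre 1 i)) - L j < 20 * Re (f (vB j i))"
    "20 * Re (f (vB j i)) < 20 * (L j * Re (centre 1 i)) + L j"
    "20 * (L j * Im (centre 1 i)) - L j < 20 * Im (f (vB j i))"
    "20 * Im (f (vB j i)) < 20 * (L j * Im (centre 1 i)) + L j" by linarith+
qed

lemma posA0: "- L j < 20 * Re (f (vA j 0))" "20 * Re (f (vA j 0)) < L j"
    "19 * L j < 20 * Im (f (vA j 0))" "20 * Im (f (vA j 0)) < 21 * L j"
  using posA[of j 0] by (simp_all add: centre_def mult.commute)

lemma posA1: "- 21 * L j < 20 * Re (f (vA j (Suc 0)))" "20 * Re (f (vA j (Suc 0))) < - 19 * L j"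
    "- 21 * L j < 20 * Im (f (vA j (Suc 0)))" "20 * Im (f (vA j (Suc 0))) < - 19 * L j"
  using posA[of j 1] by (simp_all add: centre_def mult.commute)

lemma posA2: "19 * L j < 20 * Re (f (vA j 2))" "20 * Re (f (vA j 2)) < 21 * L j"
    "- 21 * L j < 20 * Im (f (vA j 2))" "20 * Im (f (vA j 2)) < - 19 * L j"
  using posA[of j 2] by (simp_all add: centre_def mult.commute)

lemma posA3: assumes "i \<ge> 3"
  shows "- L j < 20 * Re (f (vA j i))" "20 * Re (f (vA j i)) < L j"
    "11 * L j < 20 * Im (f (vA j i))" "20 * Im (f (vA j i)) < 13 * L j"
  using posA[of j i] assms by (simp_all add: centre_def mult.commute)

lemma posB0: "- L j < 20 * Re (f (vB j 0))" "20 * Re (f (vB j 0)) < L j"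
    "- 61 * L j < 20 * Im (f (vB j 0))" "20 * Im (f (vB j 0)) < - 59 * L j"
  using posB[of j 0] by (simp_all add: centre_def mult.commute)

lemma posB1: assumes "i > 0"
  shows "- L j < 20 * Re (f (vB j i))" "20 * Re (f (vB j i)) < L j"
    "- 41 * L j < 20 * Im (f (vB j i))" "20 * Im (f (vB j i)) < - 39 * L j"
  using posB[of j i] assms by (simp_all add: centre_def mult.commute)

lemma index_cases: "i = 0 \<or> i = Suc 0 \<or> i = 2 \<or> i \<ge> (3::nat)" by auto

lemma posA_bounds: "- 21 * L j \<le> 20 * Re (f (vA j i))" "20 * Re (f (vA j i)) \<le> 21 * L j"
    "- 21 * L j \<le> 20 * Im (f (vA j i))" "20 * Im (f (vA j i)) \<le> 21 * L j"
  using index_cases[of i] posA0[of j] posA1[of j] posA2[of j] posA3[of i j] L_pos[of j] by auto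

lemma posB_bounds: "- L j \<le> 20 * Re (f (vB j i))" "20 * Re (f (vB j i)) \<le> L j"
    "- 61 * L j \<le> 20 * Im (f (vB j i))" "20 * Im (f (vB j i)) \<le> - 39 * L j"
  using posB0[of j] posB1[of i j] L_pos[of j] by (cases "i = 0"; auto)+

text \<open>The lines of slope 2 and -2 pass through the origin, so with
  \<open>B_below_wedge\<close> they separate the two chains on all levels at once. Being steeper
  than the diagonals through the corners, each leaves only one corner of a level below it.\<close>

lemma A_above_wedge:
  assumes "x \<in> KA p j"
  shows "x \<noteq> vA (Suc j) 2 \<Longrightarrow> Im (f x) + (-2) * Re (f x) > 0"
    and "x \<noteq> vA (Suc j) 1 \<Longrightarrow> Im (f x) + 2 * Re (f x) > 0"
proof -
  consider "x = vA j 0" | i where "x = vA (Suc j) i" using assms by (auto simp: KA_def)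
  then have "(x \<noteq> vA (Suc j) 2 \<longrightarrow> Im (f x) + (-2) * Re (f x) > 0) \<and> (x \<noteq> vA (Suc j) 1 \<longrightarrow> Im (f x) + 2 * Re (f x) > 0)"
  proof cases
    case 1
    then show ?thesis using posA0[of j] L_pos[of j] by auto
  next
    case 2
    then show ?thesis
      using index_cases[of i] posA0[of "Suc j"] posA1[of "Suc j"] posA2[of "Suc j"] posA3[of i "Suc j"] L_pos[of "Suc j"]
      by auto
  qed
  then show "x \<noteq> vA (Suc j) 2 \<Longrightarrow> Im (f x) + (-2) * Re (f x) > 0" "x \<noteq> vA (Suc j) 1 \<Longrightarrow> Im (f x) + 2 * Re (f x) > 0" by auto
qed

lemma B_below_wedge:
  assumes "x \<in> KB p j"
  shows "Im (f x) + (-2) * Re (f x) < 0" "Im (f x) + 2 * Re (f x) < 0"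
proof -
  obtain l i where "x = vB l i" using assms by (auto simp: KB_def)
  then show "Im (f x) + (-2) * Re (f x) < 0" "Im (f x) + 2 * Re (f x) < 0"
    using posB_bounds[of l i] L_pos[of l] by auto
qed

text \<open>The slope 3/2 is chosen between about 1 and 2: steep enough for a corner of level
  \<open>j + 1\<close> to clear a line through the apex of level \<open>j\<close>, flat enough for
  the corners of level \<open>j\<close> to stay below that line
  (\<open>A_below_apex\<close>).\<close>

lemma A_above_apex:
  assumes "x \<in> KA p j" "x \<noteq> vA j 0"
  shows "x \<noteq> vA (Suc j) 2 \<Longrightarrow> Im (f x) + (-3/2) * Re (f x) > Im (f (vA j 0)) + (-3/2) * Re (f (vA j 0))"
    and "x \<noteq> vA (Suc j) 1 \<Longrightarrow> Im (f x) + (3/2) * Re (f x) > Im (f (vA j 0)) + (3/2) * Re (f (vA j 0))"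
proof -
  obtain i where x: "x = vA (Suc j) i" using assms by (auto simp: KA_def)
  have *: "320 * Re (f (vA j 0)) < L (Suc j)" "- L (Suc j) < 320 * Re (f (vA j 0))"
    "320 * Im (f (vA j 0)) < 21 * L (Suc j)"
    using posA0[of j] L_Suc[of j] by auto
  show "x \<noteq> vA (Suc j) 2 \<Longrightarrow> Im (f x) + (-3/2) * Re (f x) > Im (f (vA j 0)) + (-3/2) * Re (f (vA j 0))"
    "x \<noteq> vA (Suc j) 1 \<Longrightarrow> Im (f x) + (3/2) * Re (f x) > Im (f (vA j 0)) + (3/2) * Re (f (vA j 0))"
    using index_cases[of i] posA0[of "Suc j"] posA1[of "Suc j"] posA2[of "Suc j"] posA3[of i "Suc j"]
      L_pos[of "Suc j"] * x
    by auto
qed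

lemma A_below_apex:
  assumes "l \<le> j" "vA l i \<noteq> vA j 0"
  shows "Im (f (vA l i)) + (-3/2) * Re (f (vA l i)) < Im (f (vA j 0)) + (-3/2) * Re (f (vA j 0))"
    "Im (f (vA l i)) + (3/2) * Re (f (vA l i)) < Im (f (vA j 0)) + (3/2) * Re (f (vA j 0))"
proof -
  have "(Im (f (vA l i)) + (-3/2) * Re (f (vA l i)) < Im (f (vA j 0)) + (-3/2) * Re (f (vA j 0))) \<and>
    (Im (f (vA l i)) + (3/2) * Re (f (vA l i)) < Im (f (vA j 0)) + (3/2) * Re (f (vA j 0)))"
  proof (cases "l = j")
    case True
    then show ?thesis
      using index_cases[of i] assms posA0[of j] posA1[of j] posA2[of j] posA3[of i j] L_pos[of j]
      by auto
  next
    case False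
    then have "16 * L l \<le> L j" using assms L_less by simp
    then show ?thesis using posA_bounds[of l i] posA0[of j] L_pos[of l]
      by auto
  qed
  then show "Im (f (vA l i)) + (-3/2) * Re (f (vA l i)) < Im (f (vA j 0)) + (-3/2) * Re (f (vA j 0))"
    "Im (f (vA l i)) + (3/2) * Re (f (vA l i)) < Im (f (vA j 0)) + (3/2) * Re (f (vA j 0))" by auto
qed

lemma B_below_apex:
  "Im (f (vB l i)) + (-3/2) * Re (f (vB l i)) < Im (f (vA j 0)) + (-3/2) * Re (f (vA j 0))"
  "Im (f (vB l i)) + (3/2) * Re (f (vB l i)) < Im (f (vA j 0)) + (3/2) * Re (f (vA j 0))"
  using posB_bounds[of l i] posA0[of j] L_pos[of l] L_pos[of j]
  by auto

lemma base_Im: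
  assumes "x \<in> base j"
  shows "- 21 * L (Suc j) \<le> 20 * Im (f x)" "20 * Im (f x) \<le> - 19 * L (Suc j)"
  using assms posA1[of "Suc j"] posA2[of "Suc j"] by (auto simp: base_def)

definition apart :: "nat set \<Rightarrow> nat set \<Rightarrow> bool" where
  "apart e g \<longleftrightarrow> edge_interior (straight f) e \<inter> edge_interior (straight f) g = {}"

lemma apart_sym: "apart e g \<Longrightarrow> apart g e"
  by (auto simp: apart_def)

lemma apartI:
  assumes "card e = 2" "card g = 2"
    and "\<And>x. x \<in> e \<Longrightarrow> Im (f x) + t * Re (f x) \<le> \<gamma>"
    and "\<And>x. x \<in> g \<Longrightarrow> \<gamma> \<le> Im (f x) + t * Re (f x)"
    and "(\<exists>x\<in>e. Im (f x) + t * Re (f x) < \<gamma>) \<or> (\<exists>x\<in>g. \<gamma> < Im (f x) + t * Re (f x))"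
  shows "apart e g"
proof -
  obtain a b where ab: "e = {a, b}" "a \<noteq> b" using assms(1) by (auto simp: card_2_iff)
  obtain c d where cd: "g = {c, d}" "c \<noteq> d" using assms(2) by (auto simp: card_2_iff)
  have "linear (\<lambda>z. Im z + t * Re z)" by (rule linearI) (auto simp: algebra_simps)
  then have "open_segment (f a) (f b) \<inter> open_segment (f c) (f d) = {}"
    by (rule open_segments_separated[where \<gamma> = \<gamma>]) (use assms ab cd in auto)
  then show ?thesis
    using ab cd general_position_inj[OF gp] by (simp add: apart_def edge_interior_straight)
qed

lemma apartI_less:
  assumes "card e = 2" "card g = 2"
    and e: "\<And>x. x \<in> e \<Longrightarrow> Im (f x) + t * Re (f x) < \<gamma>"
    and g: "\<And>x. x \<in> g \<Longrightarrow> \<gamma> \<le> Im (f x) + t * Re (f x)"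
  shows "apart e g" "apart g e"
proof -
  obtain x where "x \<in> e" using assms(1) by fastforce
  then have "\<exists>x\<in>e. Im (f x) + t * Re (f x) < \<gamma>" using e by blast
  then show "apart e g" using less_imp_le[OF e] g by (intro apartI[OF assms(1,2)]) auto
  then show "apart g e" by (rule apart_sym)
qed

lemma apartI_greater:
  assumes "card e = 2" "card g = 2"
    and e: "\<And>x. x \<in> e \<Longrightarrow> \<gamma> < Im (f x) + t * Re (f x)"
    and g: "\<And>x. x \<in> g \<Longrightarrow> Im (f x) + t * Re (f x) \<le> \<gamma>"
  shows "apart e g" "apart g e"
proof -
  obtain x where "x \<in> e" using assms(1) by fastforce
  then have "\<exists>x\<in>e. \<gamma> < Im (f x) + t * Re (f x)" using e by blast
  then show "apart g e" using less_imp_le[OF e] g by (intro apartI[OF assms(2,1)]) auto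
  then show "apart e g" by (rule apart_sym)
qed

lemma clique_other: "e \<in> clique K \<Longrightarrow> \<exists>x\<in>e. x \<noteq> a"
  by (auto simp: clique_def card_2_iff)

lemma base_eqI: "\<lbrakk>e \<in> clique K; vA (Suc j) 1 \<in> e; vA (Suc j) 2 \<in> e\<rbrakk> \<Longrightarrow> e = base j"
  by (auto simp: clique_def card_2_iff base_def)

lemma KA_level: "x \<in> KA p i \<Longrightarrow> \<exists>l c. x = vA l c \<and> (l = i \<and> c = 0 \<or> l = Suc i)"
  by (auto simp: KA_def)

lemma KB_level: "x \<in> KB p i \<Longrightarrow> \<exists>l c. x = vB l c \<and> (l = i \<and> c = 0 \<or> l = Suc i)"
  by (auto simp: KB_def)

end

section \<open>Which edges cross\<close>

context placed
begin

text \<open>An edge of the outer clique missing a corner lies above a tilted line through the hinge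
  \<open>vA j 0\<close>. Only the base contains both corners, and a horizontal line handles
  it.\<close>

lemma apart_AA:
  assumes "i < j" "e \<in> clique (KA p i)" "g \<in> clique (KA p j)"
  shows "apart e g"
proof -
  have c2: "card e = 2" "card g = 2" using assms by (auto dest: clique_card)
  have sub: "e \<subseteq> KA p i" "g \<subseteq> KA p j" using assms by (auto simp: clique_def)
  \<comment> \<open>Both edges may contain the hinge, which lies on the separating line; strictness
    comes from the other endpoint of \<open>g\<close>.\<close>
  obtain y where y: "y \<in> g" "y \<noteq> vA j 0" using clique_other[OF assms(3)] by blast
  have e: "Im (f x) + (-3/2) * Re (f x) \<le> Im (f (vA j 0)) + (-3/2) * Re (f (vA j 0)) \<and>
      Im (f x) + (3/2) * Re (f x) \<le> Im (f (vA j 0)) + (3/2) * Re (f (vA j 0))" if "x \<in> e" for x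
  proof -
    obtain l c where "x = vA l c" "l = i \<and> c = 0 \<or> l = Suc i" using KA_level[of x i] sub \<open>x \<in> e\<close> by blast
    then have lc: "x = vA l c" "l \<le> j" using assms(1) by auto
    show ?thesis using A_below_apex[OF lc(2), of c] lc(1) by (cases "x = vA j 0") auto
  qed
  consider "vA (Suc j) 2 \<notin> g" | "vA (Suc j) 1 \<notin> g" | "g = base j" using base_eqI[OF assms(3)] by blast
  then show ?thesis
  proof cases
    case 1
    have "Im (f x) + (-3/2) * Re (f x) \<ge> Im (f (vA j 0)) + (-3/2) * Re (f (vA j 0))" if "x \<in> g" for x
      using A_above_apex(1)[of x j] that 1 sub by (cases "x = vA j 0") (auto intro: less_imp_le)
    moreover have "Im (f y) + (-3/2) * Re (f y) > Im (f (vA j 0)) + (-3/2) * Re (f (vA j 0))"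
      by (rule A_above_apex(1)) (use 1 y sub in auto)
    ultimately show ?thesis using e y by (intro apartI[OF c2]) blast+
  next
    case 2
    have "Im (f x) + (3/2) * Re (f x) \<ge> Im (f (vA j 0)) + (3/2) * Re (f (vA j 0))" if "x \<in> g" for x
      using A_above_apex(2)[of x j] that 2 sub by (cases "x = vA j 0") (auto intro: less_imp_le)
    moreover have "Im (f y) + (3/2) * Re (f y) > Im (f (vA j 0)) + (3/2) * Re (f (vA j 0))"
      by (rule A_above_apex(2)) (use 2 y sub in auto)
    ultimately show ?thesis using e y by (intro apartI[OF c2]) blast+
  next
    case 3
    have e': "Im (f x) > - 19/20 * L (Suc j)" if "x \<in> e" for x
    proof -
      obtain l c where "x = vA l c" "l = i \<and> c = 0 \<or> l = Suc i" using KA_level[of x i] sub \<open>x \<in> e\<close> by blast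
      then have lc: "x = vA l c" "l < Suc j" using assms(1) by auto
      show ?thesis using posA_bounds(3)[of l c] L_less[OF lc(2)] L_pos[of l] unfolding lc(1) by linarith
    qed
    have g': "Im (f x) \<le> - 19/20 * L (Suc j)" if "x \<in> g" for x using base_Im[of x j] that 3 by simp
    show ?thesis
      by (rule apartI_greater[where t = 0 and \<gamma> = "- 19/20 * L (Suc j)"]) (use c2 e' g' in auto)
  qed
qed

lemma B_order:
  assumes "l \<le> j" "vB l c \<noteq> vB j 0"
  shows "Im (f (vB j 0)) < Im (f (vB l c))"
proof (cases "l = j")
  case True
  then show ?thesis using assms posB0[of j] posB1[of c j] L_pos[of j] by auto
next
  case False
  then show ?thesis using assms L_less[of l j] posB0[of j] posB_bounds[of l c] L_pos[of l] by auto
qed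

lemma B_order': "l < j \<Longrightarrow> Im (f (vB j c)) < Im (f (vB l 0))"
  using L_less[of l j] posB0[of l] posB_bounds[of j c] L_pos[of l] by auto

text \<open>The second chain descends: \<open>vB j 0\<close> is lowest among the levels up to
  \<open>j\<close> and above all later ones, so a horizontal line through it works.\<close>

lemma apart_BB:
  assumes "i < j" "e \<in> clique (KB p i)" "g \<in> clique (KB p j)"
  shows "apart e g"
proof -
  have c2: "card e = 2" "card g = 2" using assms by (auto dest: clique_card)
  have sub: "e \<subseteq> KB p i" "g \<subseteq> KB p j" using assms by (auto simp: clique_def)
  have e: "Im (f (vB j 0)) \<le> Im (f x)" if "x \<in> e" for x
  proof -
    obtain l c where "x = vB l c" "l = i \<and> c = 0 \<or> l = Suc i" using KB_level[of x i] sub \<open>x \<in> e\<close> by blast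
    then have lc: "x = vB l c" "l \<le> j" using assms(1) by auto
    show ?thesis using B_order[OF lc(2), of c] lc(1) by (cases "x = vB j 0") auto
  qed
  have g: "Im (f x) < Im (f (vB j 0))" if "x \<in> g" "x \<noteq> vB j 0" for x
  proof -
    obtain c where "x = vB (Suc j) c" using sub \<open>x \<in> g\<close> \<open>x \<noteq> vB j 0\<close> by (auto simp: KB_def)
    then show ?thesis using B_order'[of j "Suc j" c] by simp
  qed
  obtain y where y: "y \<in> g" "y \<noteq> vB j 0" using clique_other[OF assms(3)] by blast
  have g': "Im (f x) \<le> Im (f (vB j 0))" if "x \<in> g" for x
    using g[OF that] by (cases "x = vB j 0") auto
  have "\<exists>x\<in>g. Im (f x) < Im (f (vB j 0))" using g y by blast
  then have "apart g e"
    by (intro apartI[where t = 0 and \<gamma> = "Im (f (vB j 0))"]) (use c2 e g' in auto)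
  then show ?thesis by (rule apart_sym)
qed

text \<open>Any edge of the first chain other than a base misses a corner and is cut off by a line
  of the wedge. The height of \<open>base i\<close> lies between levels \<open>i\<close> and
  \<open>i + 1\<close> of the second chain, so it is passed only by edges coming from
  \<open>vB i 0\<close>.\<close>

lemma crossing_AB:
  assumes "e \<in> clique (KA p i)" "g \<in> clique (KB p j)" "\<not> apart e g"
  shows "e = base i \<and> i = j \<and> vB j 0 \<in> g"
proof -
  have c2: "card e = 2" "card g = 2" using assms by (auto dest: clique_card)
  have sub: "e \<subseteq> KA p i" "g \<subseteq> KB p j" using assms by (auto simp: clique_def)
  have "\<not> (vA (Suc i) 2 \<notin> e)"
  proof
    assume "vA (Suc i) 2 \<notin> e"
    then have "Im (f x) + (-2) * Re (f x) > 0" if "x \<in> e" for x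
      using A_above_wedge(1)[of x i] that sub by blast
    moreover have "Im (f x) + (-2) * Re (f x) \<le> 0" if "x \<in> g" for x
      using B_below_wedge(1)[of x j] that sub by (auto intro: less_imp_le)
    ultimately have "apart e g" by (rule apartI_greater(1)[OF c2])
    then show False using assms(3) by blast
  qed
  moreover have "\<not> (vA (Suc i) 1 \<notin> e)"
  proof
    assume "vA (Suc i) 1 \<notin> e"
    then have "Im (f x) + 2 * Re (f x) > 0" if "x \<in> e" for x
      using A_above_wedge(2)[of x i] that sub by blast
    moreover have "Im (f x) + 2 * Re (f x) \<le> 0" if "x \<in> g" for x
      using B_below_wedge(2)[of x j] that sub by (auto intro: less_imp_le)
    ultimately have "apart e g" by (rule apartI_greater(1)[OF c2])
    then show False using assms(3) by blast
  qed
  ultimately have eb: "e = base i" using base_eqI[OF assms(1)] by blast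
  have lv: "\<exists>l c. x = vB l c \<and> (l = j \<and> c = 0 \<or> l = Suc j)" if "x \<in> g" for x
    using KB_level[of x j] that sub by blast
  have le: "j \<le> i"
  proof (rule ccontr)
    assume "\<not> j \<le> i"
    then have ij: "Suc i \<le> j" by simp
    have "Im (f x) < - 21/20 * L (Suc i)" if "x \<in> g" for x
    proof -
      obtain l c where lc: "x = vB l c" "l \<ge> j" using lv[OF \<open>x \<in> g\<close>] by auto
      show ?thesis using posB_bounds(4)[of l c] L_mono[of "Suc i" l] L_pos[of l] lc ij by auto
    qed
    moreover have "- 21/20 * L (Suc i) \<le> Im (f x)" if "x \<in> e" for x using base_Im[of x i] that eb by simp
    ultimately have "apart e g"
      by (intro apartI_less(2)[where t = 0 and \<gamma> = "- 21/20 * L (Suc i)"] c2) auto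
    then show False using assms(3) by blast
  qed
  have ge: "i \<le> j"
  proof (rule ccontr)
    assume "\<not> i \<le> j"
    then have ij: "Suc j \<le> i" by simp
    have "Im (f x) > - 19/20 * L (Suc i)" if "x \<in> g" for x
    proof -
      obtain l c where lc: "x = vB l c" "l < Suc i" using lv[OF \<open>x \<in> g\<close>] ij by auto
      show ?thesis using posB_bounds(3)[of l c] L_less[of l "Suc i"] L_pos[of l] lc by auto
    qed
    moreover have "Im (f x) \<le> - 19/20 * L (Suc i)" if "x \<in> e" for x using base_Im[of x i] that eb by simp
    ultimately have "apart e g"
      by (intro apartI_greater(2)[where t = 0 and \<gamma> = "- 19/20 * L (Suc i)"] c2) auto
    then show False using assms(3) by blast
  qed
  have "vB j 0 \<in> g"
  proof (rule ccontr)
    assume no: "vB j 0 \<notin> g"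
    have "Im (f x) < - 21/20 * L (Suc i)" if "x \<in> g" for x
    proof -
      have "x \<in> KB p j" "x \<noteq> vB j 0" using that sub no by auto
      then obtain c where x: "x = vB (Suc i) c" using le ge by (auto simp: KB_def)
      show ?thesis using posB_bounds(4)[of "Suc i" c] L_pos[of "Suc i"] x by auto
    qed
    moreover have "- 21/20 * L (Suc i) \<le> Im (f x)" if "x \<in> e" for x using base_Im[of x i] that eb by simp
    ultimately have "apart e g"
      by (intro apartI_less(2)[where t = 0 and \<gamma> = "- 21/20 * L (Suc i)"] c2) auto
    then show False using assms(3) by blast
  qed
  then show ?thesis using eb le ge by simp
qed

lemma apart_common_vertex:
  assumes "card e = 2" "card g = 2" "e \<noteq> g" "x \<in> e" "x \<in> g"
  shows "apart e g"
proof (rule ccontr)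
  obtain a b where ab: "e = {a, b}" "a \<noteq> b" using assms(1) by (auto simp: card_2_iff)
  obtain c d where cd: "g = {c, d}" "c \<noteq> d" using assms(2) by (auto simp: card_2_iff)
  assume "\<not> apart e g"
  then obtain y where "y \<in> open_segment (f a) (f b)" "y \<in> open_segment (f c) (f d)"
    using ab cd general_position_inj[OF gp] by (auto simp: apart_def edge_interior_straight)
  then have "distinct [a, b, c, d]"
    using crossing_disjoint_ends[OF gp, of a b c d y] assms(3) ab cd by blast
  then show False using assms(4,5) ab cd by auto
qed

text \<open>As a hull side the base has no crossings within its clique, which leaves its whole
  budget to the second chain.\<close>

lemma apart_base:
  assumes "g \<in> clique (KA p j)" "g \<noteq> base j"
  shows "apart (base j) g"
proof (cases "g \<inter> base j = {}")
  case True
  have c2: "card (base j) = 2" "card g = 2" using assms by (auto dest: clique_card simp: base_def)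
  have "Im (f x) > 0" if "x \<in> g" for x
  proof -
    have "x \<in> KA p j" "x \<noteq> vA (Suc j) 1" "x \<noteq> vA (Suc j) 2"
      using that assms True by (auto simp: clique_def base_def)
    then show ?thesis using A_above_wedge[of x j] by simp
  qed
  moreover have "Im (f x) < 0" if "x \<in> base j" for x using base_Im[OF that] L_pos[of "Suc j"] by linarith
  ultimately show ?thesis
    by (intro apartI_less(1)[where t = 0 and \<gamma> = 0] c2) (auto intro: less_imp_le)
next
  case False
  then obtain x where "x \<in> g" "x \<in> base j" by blast
  then show ?thesis
    using assms by (intro apart_common_vertex) (auto dest: clique_card simp: base_def)
qed

lemma cut_edge_Im:
  assumes "x \<in> cut_edge m" shows "- 61 * L m \<le> 20 * Im (f x)"
  using assms posA_bounds(3)[of m 1] posB_bounds(3)[of m 0] L_pos[of m] by (auto simp: cut_edge_def)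

text \<open>A supporting line at the left corner of level \<open>m\<close>: the first chain up to
  that level lies on one side, the cut edge on the other.\<close>

lemma A_above_cut_edge_line:
  assumes "l \<le> m"
  shows "Im (f (vA m 1)) + (1/2) * Re (f (vA m 1)) \<le> Im (f (vA l c)) + (1/2) * Re (f (vA l c))"
proof (cases "l = m")
  case True
  then show ?thesis
    using index_cases[of c] posA0[of m] posA1[of m] posA2[of m] posA3[of c m] L_pos[of m] by auto
next
  case False
  then show ?thesis
    using assms L_less[of l m] posA1[of m] posA_bounds[of l c] L_pos[of l] by auto
qed

lemma cut_edge_below_line:
  "Im (f (vB m 0)) + (1/2) * Re (f (vB m 0)) < Im (f (vA m 1)) + (1/2) * Re (f (vA m 1))"
  using posA1[of m] posB0[of m] L_pos[of m] by auto

text \<open>Cliques up to level \<open>m\<close> lie beyond the supporting line at the left corner.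
  For later cliques the cut edge behaves like an inner edge, and the lines of
  \<open>apart_AA\<close> apply.\<close>

lemma apart_TA:
  assumes "g \<in> clique (KA p j)"
  shows "apart (cut_edge m) g"
proof -
  have c2: "card (cut_edge m) = 2" "card g = 2" using assms by (auto dest: clique_card simp: card_cut_edge)
  have sub: "g \<subseteq> KA p j" using assms by (auto simp: clique_def)
  show ?thesis
  proof (cases "Suc j \<le> m")
    case True
    have "Im (f (vA m 1)) + (1/2) * Re (f (vA m 1)) \<le> Im (f x) + (1/2) * Re (f x)" if "x \<in> g" for x
    proof -
      obtain l c where "x = vA l c" "l = j \<and> c = 0 \<or> l = Suc j" using KA_level[of x j] sub \<open>x \<in> g\<close> by blast
      then show ?thesis using A_above_cut_edge_line[of l m c] True by auto
    qed
    then show ?thesis using cut_edge_below_line[of m]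
      by (intro apartI[where t = "1/2" and \<gamma> = "Im (f (vA m 1)) + (1/2) * Re (f (vA m 1))"] c2)
        (auto simp: cut_edge_def)
  next
    case False
    then have mj: "m \<le> j" by simp
    have l: "Im (f x) + (-3/2) * Re (f x) < Im (f (vA j 0)) + (-3/2) * Re (f (vA j 0)) \<and>
      Im (f x) + (3/2) * Re (f x) < Im (f (vA j 0)) + (3/2) * Re (f (vA j 0))" if "x \<in> cut_edge m" for x
      using that A_below_apex[OF mj, of 1] B_below_apex[of m 0 j] by (auto simp: cut_edge_def)
    consider "vA (Suc j) 2 \<notin> g" | "vA (Suc j) 1 \<notin> g" | "g = base j" using base_eqI[OF assms] by blast
    then show ?thesis
    proof cases
      case 1
      have "Im (f x) + (-3/2) * Re (f x) \<ge> Im (f (vA j 0)) + (-3/2) * Re (f (vA j 0))" if "x \<in> g" for x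
        using A_above_apex(1)[of x j] that 1 sub by (cases "x = vA j 0") (auto intro: less_imp_le)
      then show ?thesis using l by (intro apartI_less(1)[OF c2]) blast+
    next
      case 2
      have "Im (f x) + (3/2) * Re (f x) \<ge> Im (f (vA j 0)) + (3/2) * Re (f (vA j 0))" if "x \<in> g" for x
        using A_above_apex(2)[of x j] that 2 sub by (cases "x = vA j 0") (auto intro: less_imp_le)
      then show ?thesis using l by (intro apartI_less(1)[OF c2]) blast+
    next
      case 3
      have "Im (f x) > - 19/20 * L (Suc j)" if "x \<in> cut_edge m" for x
        using cut_edge_Im[OF that] L_less[of m "Suc j"] mj L_pos[of m] by auto
      moreover have "Im (f x) \<le> - 19/20 * L (Suc j)" if "x \<in> g" for x
        using base_Im[of x j] that 3 by simp
      ultimately show ?thesis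
        by (intro apartI_greater(1)[where t = 0 and \<gamma> = "- 19/20 * L (Suc j)"] c2) auto
    qed
  qed
qed

lemma apart_TB:
  assumes "g \<in> clique (KB p j)"
  shows "apart (cut_edge m) g"
proof -
  have c2: "card (cut_edge m) = 2" "card g = 2" using assms by (auto dest: clique_card simp: card_cut_edge)
  have sub: "g \<subseteq> KB p j" using assms by (auto simp: clique_def)
  show ?thesis
  proof (cases "Suc j \<le> m")
    case True
    \<comment> \<open>A coefficient above 2 is required: in units of the scale it must bring the
      left corner, at -1 - 3, below the hinge at -3. The vertices near the axis are hardly
      affected.\<close>
    have "Im (f (vB m 0)) + 3 * Re (f (vB m 0)) \<le> Im (f x) + 3 * Re (f x)" if "x \<in> g" for x
    proof -
      obtain l c where "x = vB l c" "l = j \<and> c = 0 \<or> l = Suc j" using KB_level[of x j] sub \<open>x \<in> g\<close> by blast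
      then have lc: "x = vB l c" "l \<le> m" using True by auto
      show ?thesis
      proof (cases "l = m")
        case True
        then show ?thesis using lc posB0[of m] posB1[of c m] L_pos[of m] by (cases "c = 0") auto
      next
        case False
        then show ?thesis using lc posB0[of m] posB_bounds[of l c] L_less[of l m] L_pos[of l] by auto
      qed
    qed
    moreover have "Im (f (vA m 1)) + 3 * Re (f (vA m 1)) < Im (f (vB m 0)) + 3 * Re (f (vB m 0))"
      using posA1[of m] posB0[of m] L_pos[of m] by auto
    ultimately show ?thesis
      by (intro apartI[where t = 3 and \<gamma> = "Im (f (vB m 0)) + 3 * Re (f (vB m 0))"] c2) (auto simp: cut_edge_def)
  next
    case False
    have "Im (f x) \<le> Im (f (vB m 0))" if "x \<in> g" for x
    proof -
      obtain l c where "x = vB l c" "l = j \<and> c = 0 \<or> l = Suc j" using KB_level[of x j] sub \<open>x \<in> g\<close> by blast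
      then have lc: "x = vB l c" "l = m \<and> c = 0 \<or> m < l" using False by auto
      then show ?thesis using B_order'[of m l c] by auto
    qed
    moreover have "Im (f (vB m 0)) < Im (f (vA m 1))" using posA1[of m] posB0[of m] L_pos[of m] by auto
    ultimately have "apart g (cut_edge m)"
      by (intro apartI[where t = 0 and \<gamma> = "Im (f (vB m 0))"] c2) (auto simp: cut_edge_def)
    then show ?thesis by (rule apart_sym)
  qed
qed

lemma apart_TT:
  assumes "m < n" shows "apart (cut_edge m) (cut_edge n)"
proof -
  have "Im (f x) > - 19/20 * L n" if "x \<in> cut_edge m" for x
    using cut_edge_Im[OF that] L_less[OF assms] L_pos[of m] by auto
  moreover have "Im (f x) \<le> - 19/20 * L n" if "x \<in> cut_edge n" for x
    using that posA1[of n] posB0[of n] L_pos[of n] by (auto simp: cut_edge_def)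
  ultimately show ?thesis
    by (intro apartI_greater(1)[where t = 0 and \<gamma> = "- 19/20 * L n"] card_cut_edge) auto
qed

end

section \<open>The unique minimum edge cut\<close>

text \<open>The gap is \<open>Suc r\<close> because \<open>walk_length\<close> loses one level.
  Starting from \<open>Suc i\<close> avoids level 0, where the graph contains only the hinges and no
  left corner.\<close>

definition cut_edges :: "nat \<Rightarrow> nat \<Rightarrow> nat set set" where
  "cut_edges p r = (\<lambda>i. cut_edge (Suc i * Suc r)) ` {..<p}"

definition VA :: "nat \<Rightarrow> nat \<Rightarrow> nat set" where "VA p r = (\<Union>j < Suc (p * Suc r). KA p j)"
definition VB :: "nat \<Rightarrow> nat \<Rightarrow> nat set" where "VB p r = (\<Union>j < Suc (p * Suc r). KB p j)"

definition graph_edges :: "nat \<Rightarrow> nat \<Rightarrow> nat set set" where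
  "graph_edges p r = (\<Union>j < Suc (p * Suc r). clique (KA p j)) \<union> (\<Union>j < Suc (p * Suc r). clique (KB p j)) \<union> cut_edges p r"

lemma cut_edgesE:
  assumes "t \<in> cut_edges p r"
  obtains i where "i < p" "t = cut_edge (Suc i * Suc r)" "Suc i * Suc r \<le> p * Suc r"
proof -
  obtain i where i: "i < p" "t = cut_edge (Suc i * Suc r)" using assms by (auto simp: cut_edges_def)
  then have "Suc i * Suc r \<le> p * Suc r" by (intro mult_le_mono1) simp
  with i show ?thesis using that by blast
qed

lemma card_cut_edges: "card (cut_edges p r) = p"
proof -
  have "inj_on (\<lambda>i. cut_edge (Suc i * Suc r)) {..<p}"
  proof (rule inj_onI)
    fix i i' assume "cut_edge (Suc i * Suc r) = cut_edge (Suc i' * Suc r)"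
    then show "i = i'" by (auto simp add: cut_edge_def doubleton_eq_iff simp del: mult_Suc mult_Suc_right)
  qed
  then show ?thesis by (simp add: cut_edges_def card_image)
qed

lemma cut_edge_ends:
  assumes "t \<in> cut_edges p r" "p > 0"
  obtains a b where "t = {a, b}" "a \<in> VA p r" "b \<in> VB p r"
proof -
  obtain i where i: "t = cut_edge (Suc i * Suc r)" "Suc i * Suc r \<le> p * Suc r" using assms(1) by (rule cut_edgesE)
  obtain m where m: "Suc i * Suc r = Suc m" by (metis mult_Suc add_Suc)
  have "vA (Suc m) 1 \<in> KA p m" "vB (Suc m) 0 \<in> KB p m" using assms(2) by (auto simp: KA_def KB_def)
  moreover have "m < Suc (p * Suc r)" using i(2) m by simp
  ultimately show ?thesis using that[of "vA (Suc m) 1" "vB (Suc m) 0"] i(1) m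
    by (auto simp: cut_edge_def VA_def VB_def)
qed

lemma VA_VB_disjoint: "VA p r \<inter> VB p r = {}"
  by (auto simp: VA_def VB_def KA_def KB_def)

lemma graph_simple:
  assumes "p > 0" shows "simple_graph (VA p r \<union> VB p r) (graph_edges p r)"
  unfolding simple_graph_def
proof (intro conjI ballI)
  show "finite (VA p r \<union> VB p r)" by (simp add: VA_def VB_def)
  fix e assume "e \<in> graph_edges p r"
  then consider j where "j < Suc (p * Suc r)" "e \<in> clique (KA p j)" | j where "j < Suc (p * Suc r)" "e \<in> clique (KB p j)"
    | "e \<in> cut_edges p r" unfolding graph_edges_def by blast
  then have "e \<subseteq> VA p r \<union> VB p r \<and> card e = 2"
  proof cases
    case 3
    obtain a b where "e = {a, b}" "a \<in> VA p r" "b \<in> VB p r" using cut_edge_ends[OF 3 assms] .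
    moreover obtain i where "e = cut_edge (Suc i * Suc r)" using cut_edgesE[OF 3] .
    ultimately show ?thesis using card_cut_edge[of "Suc i * Suc r"] by auto
  qed (auto simp: clique_def VA_def VB_def)
  then show "e \<subseteq> VA p r \<union> VB p r" "card e = 2" by auto
qed

lemma sym_edges: "sym {(x, y). {x, y} \<in> E}"
  by (auto simp: sym_def insert_commute)

text \<open>Every clique alone survives the loss of all of \<open>T\<close>, so a route through the
  hinges \<open>h j\<close> survives as well.\<close>

lemma clique_chain_connected:
  assumes K: "\<And>j. finite (K j)" "\<And>j. card (K j) = p + 2"
    and E: "\<And>j. j < N \<Longrightarrow> clique (K j) \<subseteq> E" and T: "finite T" "card T \<le> p"
    and h: "\<And>j. h j \<in> K j" "\<And>j. h (Suc j) \<in> K j"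
    and xy: "x \<in> (\<Union>j<N. K j)" "y \<in> (\<Union>j<N. K j)"
  shows "(x, y) \<in> {(x, y). {x, y} \<in> E - T}\<^sup>*"
proof -
  let ?R = "{(x, y). {x, y} \<in> E - T}"
  have step: "(u, v) \<in> ?R\<^sup>*" if "j < N" "u \<in> K j" "v \<in> K j" for u v j
    by (rule clique_robust[OF K(1) K(2) E T]) (use that in auto)
  have root: "(h 0, h j) \<in> ?R\<^sup>*" if "j < N" for j
    using that
  proof (induction j)
    case (Suc j)
    then have "(h 0, h j) \<in> ?R\<^sup>*" "(h j, h (Suc j)) \<in> ?R\<^sup>*" using step[of j] h by auto
    then show ?case by (rule rtrancl_trans)
  qed simp
  have all: "(h 0, z) \<in> ?R\<^sup>*" if z: "z \<in> (\<Union>j<N. K j)" for z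
  proof -
    obtain j where j: "j < N" "z \<in> K j" using z by blast
    show ?thesis by (rule rtrancl_trans[OF root[OF j(1)] step[OF j(1) h(1) j(2)]])
  qed
  have "sym (?R\<^sup>*)" by (rule sym_rtrancl[OF sym_edges])
  then have "(x, h 0) \<in> ?R\<^sup>*" using all[OF xy(1)] by (rule symD)
  then show ?thesis using all[OF xy(2)] by (rule rtrancl_trans)
qed

text \<open>Both chains remain connected without \<open>T\<close>, so one surviving cut edge would
  reconnect the graph. Together with \<open>card_cut_edges\<close> this gives minimality and
  uniqueness at once.\<close>

lemma graph_cut_contains:
  assumes p: "p > 0" and cut: "edge_cut (VA p r \<union> VB p r) (graph_edges p r) T" and card: "card T \<le> p"
  shows "cut_edges p r \<subseteq> T"
proof
  fix t assume t: "t \<in> cut_edges p r"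
  let ?E = "graph_edges p r" and ?N = "Suc (p * Suc r)"
  let ?R = "{(x, y). {x, y} \<in> ?E - T}"
  have fin: "finite T"
    using cut finite_edges[OF graph_simple[OF p]] by (auto simp: edge_cut_def intro: finite_subset)
  have A: "(x, y) \<in> ?R\<^sup>*" if "x \<in> VA p r" "y \<in> VA p r" for x y
    by (rule clique_chain_connected[where K = "KA p" and N = ?N and h = "\<lambda>j. vA j 0", OF finite_K(1) card_K(1) _ fin card])
      (use that in \<open>auto simp: VA_def graph_edges_def KA_def\<close>)
  have B: "(x, y) \<in> ?R\<^sup>*" if "x \<in> VB p r" "y \<in> VB p r" for x y
    by (rule clique_chain_connected[where K = "KB p" and N = ?N and h = "\<lambda>j. vB j 0", OF finite_K(2) card_K(2) _ fin card])
      (use that in \<open>auto simp: VB_def graph_edges_def KB_def\<close>)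
  show "t \<in> T"
  proof (rule ccontr)
    assume "t \<notin> T"
    obtain a b where ab: "t = {a, b}" "a \<in> VA p r" "b \<in> VB p r" using cut_edge_ends[OF t p] .
    have abR: "(a, b) \<in> ?R\<^sup>*" using ab \<open>t \<notin> T\<close> t by (auto simp: graph_edges_def)
    have AB: "(x, y) \<in> ?R\<^sup>*" if "x \<in> VA p r" "y \<in> VB p r" for x y
      using A[OF that(1) ab(2)] abR B[OF ab(3) that(2)] by (meson rtrancl_trans)
    have BA: "(y, x) \<in> ?R\<^sup>*" if "x \<in> VA p r" "y \<in> VB p r" for x y
      by (rule symD[OF sym_rtrancl[OF sym_edges] AB[OF that]])
    have "graph_connected (VA p r \<union> VB p r) (?E - T)"
      unfolding graph_connected_def using A B AB BA by blast
    then show False using cut by (simp add: edge_cut_def)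
  qed
qed

lemma cut_edges_is_cut:
  "edge_cut (VA p r \<union> VB p r) (graph_edges p r) (cut_edges p r)"
proof -
  let ?R = "{(x, y). {x, y} \<in> graph_edges p r - cut_edges p r}"
  have edge: "y \<in> VA p r" if xy: "(x, y) \<in> ?R" "x \<in> VA p r" for x y
  proof -
    have xB: "x \<notin> VB p r" using VA_VB_disjoint[of p r] xy(2) by blast
    have "{x, y} \<in> graph_edges p r" "{x, y} \<notin> cut_edges p r" using xy(1) by auto
    then
    consider j where "j < Suc (p * Suc r)" "{x, y} \<in> clique (KA p j)" | j where "j < Suc (p * Suc r)" "{x, y} \<in> clique (KB p j)"
      unfolding graph_edges_def by blast
    then show ?thesis
      by cases (use xB in \<open>auto simp: clique_def VA_def VB_def\<close>)
  qed
  have "y \<in> VA p r" if "(x, y) \<in> ?R\<^sup>*" "x \<in> VA p r" for x y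
    using that
  proof (induction rule: rtrancl_induct)
    case (step y z)
    then show ?case using edge[of y z] by blast
  qed
  moreover have "vA 0 0 \<in> VA p r" "vB 0 0 \<in> VB p r" by (auto simp: VA_def VB_def KA_def KB_def)
  ultimately have "(vA 0 0, vB 0 0) \<notin> ?R\<^sup>*" using VA_VB_disjoint[of p r] by blast
  then have "\<not> graph_connected (VA p r \<union> VB p r) (graph_edges p r - cut_edges p r)"
    using \<open>vA 0 0 \<in> VA p r\<close> \<open>vB 0 0 \<in> VB p r\<close> unfolding graph_connected_def by blast
  then show ?thesis by (auto simp: edge_cut_def graph_edges_def)
qed

lemma cut_edges_unique:
  assumes p: "p > 0" shows "unique_min_edge_cut (VA p r \<union> VB p r) (graph_edges p r) (cut_edges p r)"
proof -
  let ?V = "VA p r \<union> VB p r" and ?E = "graph_edges p r"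
  have fin: "finite T" if "edge_cut ?V ?E T" for T
    using that finite_edges[OF graph_simple[OF p]] by (auto simp: edge_cut_def intro: finite_subset)
  have le: "p \<le> card T" if T: "edge_cut ?V ?E T" for T
  proof (rule ccontr)
    assume "\<not> p \<le> card T"
    then have "cut_edges p r \<subseteq> T" using graph_cut_contains[OF p T] by simp
    then have "card (cut_edges p r) \<le> card T" by (rule card_mono[OF fin[OF T]])
    then show False using card_cut_edges[of p r] \<open>\<not> p \<le> card T\<close> by simp
  qed
  have "min_edge_cut ?V ?E (cut_edges p r)"
    unfolding min_edge_cut_def card_cut_edges using cut_edges_is_cut le by blast
  moreover have "T = cut_edges p r" if T: "min_edge_cut ?V ?E T" for T
  proof -
    have c: "edge_cut ?V ?E T" using T unfolding min_edge_cut_def by blast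
    have "card T \<le> card (cut_edges p r)" using T cut_edges_is_cut[of p r] unfolding min_edge_cut_def by blast
    then have le_p: "card T \<le> p" by (simp only: card_cut_edges)
    have "cut_edges p r \<subseteq> T" by (rule graph_cut_contains[OF p c le_p])
    then have "cut_edges p r = T" by (rule card_seteq[OF fin[OF c]]) (simp only: card_cut_edges le_p)
    then show ?thesis by simp
  qed
  ultimately show ?thesis unfolding unique_min_edge_cut_def by blast
qed

section \<open>Counting crossings\<close>

context placed
begin

lemma crossing_edges_apart: "g \<in> crossing_edges E f e \<longleftrightarrow> g \<in> E \<and> g \<noteq> e \<and> \<not> apart e g"
  by (auto simp: crossing_edges_def apart_def)

lemma apart_AA_neq:
  assumes "i \<noteq> j" "e \<in> clique (KA p j)" "g \<in> clique (KA p i)" shows "apart e g"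
proof -
  from assms(1) consider "i < j" | "j < i" by linarith
  then show ?thesis by cases (use assms apart_AA apart_sym in auto)
qed

lemma apart_BB_neq:
  assumes "i \<noteq> j" "e \<in> clique (KB p j)" "g \<in> clique (KB p i)" shows "apart e g"
proof -
  from assms(1) consider "i < j" | "j < i" by linarith
  then show ?thesis by cases (use assms apart_BB apart_sym in auto)
qed

text \<open>The budget by kind of edge: at most \<open>p\<^sup>2 / 4\<close> in the first chain
  outside the bases, \<open>p + 1\<close> for a base, \<open>p\<^sup>2 / 4 + 1\<close> in the second
  chain (its clique and one base), none for a cut edge.\<close>

lemma crossing_count:
  assumes k: "p\<^sup>2 + 4 \<le> 4 * k" "p + 1 \<le> k" and e: "e \<in> graph_edges p r"
  shows "card (crossing_edges (graph_edges p r) f e) \<le> k"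
proof -
  let ?E = "graph_edges p r"
  have E: "(\<exists>j. g \<in> clique (KA p j)) \<or> (\<exists>j. g \<in> clique (KB p j)) \<or> (\<exists>m. g = cut_edge m)"
    if "g \<in> ?E" for g using that by (auto simp: graph_edges_def cut_edges_def)
  have fin: "finite (crossing_edges (clique K) f e)" if "finite K" for K
    by (rule finite_subset[of _ "Pow K"]) (use that in \<open>auto simp: crossing_edges_def clique_def\<close>)
  consider (A) j where "e \<in> clique (KA p j)" "e \<noteq> base j" | (base) j where "e \<in> clique (KA p j)" "e = base j"
    | (B) j where "e \<in> clique (KB p j)" | (T) m where "e = cut_edge m" using E[OF e] by blast
  then show ?thesis
  proof cases
    case A
    have "crossing_edges ?E f e \<subseteq> crossing_edges (clique (KA p j)) f e"
    proof
      fix g assume g: "g \<in> crossing_edges ?E f e"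
      then have na: "\<not> apart e g" "g \<in> ?E" by (auto simp: crossing_edges_apart)
      from E[OF na(2)] have "g \<in> clique (KA p j)"
      proof (elim disjE exE)
        fix i assume "g \<in> clique (KA p i)"
        then show ?thesis using apart_AA_neq[OF _ A(1)] na(1) by metis
      next
        fix i assume "g \<in> clique (KB p i)"
        then show ?thesis using crossing_AB[OF A(1) _ na(1)] A(2) by blast
      next
        fix m assume "g = cut_edge m"
        then show ?thesis using apart_TA[OF A(1)] apart_sym na(1) by blast
      qed
      then show "g \<in> crossing_edges (clique (KA p j)) f e" using g by (simp add: crossing_edges_apart)
    qed
    then have "card (crossing_edges ?E f e) \<le> card (crossing_edges (clique (KA p j)) f e)"
      by (intro card_mono fin) auto
    then show ?thesis using clique_crossings[OF gp _ card_K(1) A(1)] k by simp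
  next
    case base
    have "crossing_edges ?E f e \<subseteq> (\<lambda>x. {vB j 0, x}) ` (KB p j - {vB j 0})"
    proof
      fix g assume g: "g \<in> crossing_edges ?E f e"
      then have na: "\<not> apart e g" "g \<in> ?E" "g \<noteq> e" by (auto simp: crossing_edges_apart)
      from E[OF na(2)] have "g \<in> clique (KB p j) \<and> vB j 0 \<in> g"
      proof (elim disjE exE)
        fix i assume gi: "g \<in> clique (KA p i)"
        then have "i = j" using apart_AA_neq[OF _ base(1)] na(1) by blast
        then show ?thesis using apart_base[of g j] gi na base(2) by blast
      next
        fix i assume gi: "g \<in> clique (KB p i)"
        then show ?thesis using crossing_AB[OF base(1) gi na(1)] by blast
      next
        fix m assume "g = cut_edge m"
        then show ?thesis using apart_TA[OF base(1)] apart_sym na(1) by blast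
      qed
      then obtain x where "g = {vB j 0, x}" "x \<in> KB p j" "x \<noteq> vB j 0"
        by (auto simp: clique_def card_2_iff)
      then show "g \<in> (\<lambda>x. {vB j 0, x}) ` (KB p j - {vB j 0})" by blast
    qed
    then have "card (crossing_edges ?E f e) \<le> card (KB p j - {vB j 0})"
      by (intro surj_card_le) auto
    also have "\<dots> = p + 1"
      using card_K(2)[of p j] card_Diff_singleton[of "vB j 0" "KB p j"] by (simp add: KB_def)
    finally show ?thesis using k by simp
  next
    case B
    have "crossing_edges ?E f e \<subseteq> insert (base j) (crossing_edges (clique (KB p j)) f e)"
    proof
      fix g assume g: "g \<in> crossing_edges ?E f e"
      then have na: "\<not> apart e g" "g \<in> ?E" by (auto simp: crossing_edges_apart)
      from E[OF na(2)] have "g \<in> clique (KB p j) \<or> g = base j"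
      proof (elim disjE exE)
        fix i assume "g \<in> clique (KB p i)"
        then show ?thesis using apart_BB_neq[OF _ B] na(1) by metis
      next
        fix i assume "g \<in> clique (KA p i)"
        then show ?thesis using crossing_AB[OF _ B, of g i] na(1) apart_sym by blast
      next
        fix m assume "g = cut_edge m"
        then show ?thesis using apart_TB[OF B] apart_sym na(1) by blast
      qed
      then show "g \<in> insert (base j) (crossing_edges (clique (KB p j)) f e)"
        using g by (auto simp: crossing_edges_apart)
    qed
    then have "card (crossing_edges ?E f e) \<le> card (insert (base j) (crossing_edges (clique (KB p j)) f e))"
      by (intro card_mono) (auto intro: fin)
    also have "\<dots> \<le> Suc (card (crossing_edges (clique (KB p j)) f e))" by (rule card_insert_le_m1) auto
    finally show ?thesis using clique_crossings[OF gp _ card_K(2) B] k by simp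
  next
    case T
    have "apart e g" if "g \<in> ?E" "g \<noteq> e" for g
      using E[OF that(1)]
    proof (elim disjE exE)
      fix n assume n: "g = cut_edge n"
      then have "m \<noteq> n" using that(2) T by auto
      then consider "m < n" | "n < m" by linarith
      then show ?thesis by cases (use T n apart_TT apart_sym in auto)
    qed (use T apart_TA apart_TB in auto)
    then have "crossing_edges ?E f e = {}" using crossing_edges_apart by blast
    then show ?thesis by simp
  qed
qed

section \<open>Nested triangles as barriers\<close>

definition barrier :: "nat \<Rightarrow> complex set" where
  "barrier j = convex hull {f (vA j 1), f (vA j 2), f (vA j 0)}"

text \<open>Interpolates between triangles: it contains all vertices up to level \<open>j\<close>
  and lies inside the triangle of level \<open>j + 1\<close>.\<close>

definition square :: "nat \<Rightarrow> complex set" where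
  "square j = cbox (Complex (- 4 * L j) (- 4 * L j)) (Complex (4 * L j) (4 * L j))"

lemma in_square: "z \<in> square j \<longleftrightarrow> \<bar>Re z\<bar> \<le> 4 * L j \<and> \<bar>Im z\<bar> \<le> 4 * L j"
  by (auto simp: square_def in_cbox_complex_iff)

lemma square_mono: "i \<le> j \<Longrightarrow> square i \<subseteq> square j"
  using L_mono[of i j] by (auto simp: in_square)

lemma vertices_in_square: "f (vA j i) \<in> square j" "f (vB j i) \<in> square j"
  using posA_bounds[of j i] posB_bounds[of j i] L_pos[of j] by (auto simp: in_square abs_le_iff)

lemma barrier_subset_square: "barrier j \<subseteq> square j"
  unfolding barrier_def by (rule hull_minimal) (auto simp: vertices_in_square, simp add: square_def)

text \<open>The point is 1.3 * 0.3 < 0.7 * 0.7. The numbers combine the half-width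
  \<open>M / 4\<close> of the square with the box error \<open>M / 20\<close>: 0.7 = 0.95 - 0.25,
  1.3 = 1.05 + 0.25 and 0.3 = 0.05 + 0.25.\<close>

lemma wedge_pos:
  fixes a b c d M :: real
  assumes "M > 0" "7 * M \<le> 10 * a" "7 * M \<le> 10 * b" 
    "- 13 * M \<le> 10 * c" "10 * c \<le> 13 * M" "- 3 * M \<le> 10 * d" "10 * d \<le> 3 * M"
  shows "c * d < a * b"
proof -
  have cd: "\<bar>c\<bar> \<le> 13/10 * M" "\<bar>d\<bar> \<le> 3/10 * M" using assms by linarith+
  have "c * d \<le> \<bar>c\<bar> * \<bar>d\<bar>" by (metis abs_ge_self abs_mult)
  also have "\<dots> \<le> (13/10 * M) * (3/10 * M)" using assms(1) cd by (intro mult_mono) auto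
  also have "\<dots> < (7/10 * M) * (7/10 * M)" using assms(1) by simp
  also have "\<dots> \<le> a * b" using assms by (intro mult_mono) auto
  finally show ?thesis .
qed

lemma square_in_barrier: "square j \<subseteq> interior (barrier (Suc j))"
proof
  fix z assume z: "z \<in> square j"
  let ?u = "f (vA (Suc j) 1)" and ?w = "f (vA (Suc j) 2)" and ?v = "f (vA (Suc j) 0)"
  let ?M = "L (Suc j)"
  have M: "?M > 0" by (rule L_pos)
  have z': "- ?M \<le> 4 * Re z" "4 * Re z \<le> ?M" "- ?M \<le> 4 * Im z" "4 * Im z \<le> ?M"
    using z L_Suc[of j] by (auto simp: in_square)
  note pos = z' M posA0[of "Suc j"] posA1[of "Suc j"] posA2[of "Suc j"]
  have tri: "tri a b z = Re (a - z) * Im (b - z) - Im (a - z) * Re (b - z)" for a b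
    by (simp add: tri_def wedge_def algebra_simps)
  show "z \<in> interior (barrier (Suc j))"
    unfolding barrier_def
  proof (rule in_interior_triangle)
    have s: "Re (?u - z) < 0" "Im (?w - z) < 0" "Im (?u - z) < 0" "Re (?w - z) > 0" using pos by auto
    show "tri ?u ?w z > 0"
      unfolding tri using mult_neg_neg[OF s(1,2)] mult_neg_pos[OF s(3,4)] by linarith
    have "Im (?w - z) * Re (?v - z) < Re (?w - z) * Im (?v - z)"
      by (rule wedge_pos[OF M]) (use pos in auto)
    then show "tri ?w ?v z > 0" unfolding tri by linarith
    have "(- Im (?u - z)) * Re (?v - z) < (- Re (?u - z)) * Im (?v - z)"
      by (rule wedge_pos[OF M]) (use pos in auto)
    then show "tri ?v ?u z > 0" unfolding tri by (simp only: mult_minus_left mult_minus_right mult.commute)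
  qed
qed

lemma barriers_nested: assumes "i < j" shows "barrier i \<subseteq> interior (barrier j)"
proof -
  obtain l where l: "j = Suc l" "i \<le> l" using assms by (cases j) auto
  then show ?thesis using barrier_subset_square square_mono square_in_barrier by blast
qed

lemma closed_barrier: "closed (barrier j)"
  unfolding barrier_def by (simp add: compact_imp_closed finite_imp_compact_convex_hull)

lemma cut_edge_in_barrier: "closed_segment (f (vA m 1)) (f (vB m 0)) \<subseteq> barrier (Suc m)"
proof -
  have "closed_segment (f (vA m 1)) (f (vB m 0)) \<subseteq> square m"
    using vertices_in_square by (intro closed_segment_subset) (auto simp: square_def)
  then show ?thesis using square_in_barrier interior_subset by blast
qed

text \<open>The edge starts at a corner of the barrier, so only the interior can be avoided; the
  supporting line at that corner does it.\<close>

lemma cut_edge_outside_barrier: 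
  assumes "z \<in> closed_segment (f (vA m 1)) (f (vB m 0))" shows "z \<notin> interior (barrier m)"
proof -
  define a where "a = Complex (1/2) 1"
  define \<gamma> where "\<gamma> = a \<bullet> f (vA m 1)"
  have a: "a \<bullet> z = Im z + (1/2) * Re z" for z by (simp add: a_def inner_complex_def)
  have "barrier m \<subseteq> {z. a \<bullet> z \<ge> \<gamma>}"
    unfolding barrier_def using A_above_cut_edge_line[of m m]
    by (intro hull_minimal convex_halfspace_ge) (auto simp: \<gamma>_def a)
  then have "interior (barrier m) \<subseteq> {z. a \<bullet> z > \<gamma>}"
    using interior_mono[of "barrier m" "{z. a \<bullet> z \<ge> \<gamma>}"] interior_halfspace_ge[of a \<gamma>]
    by (simp add: a_def complex_eq_iff)
  moreover have "closed_segment (f (vA m 1)) (f (vB m 0)) \<subseteq> {z. a \<bullet> z \<le> \<gamma>}"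
    using cut_edge_below_line[of m] by (intro closed_segment_subset convex_halfspace_le) (auto simp: \<gamma>_def a)
  ultimately show ?thesis using assms by fastforce
qed

text \<open>The sides of the triangle are drawn edges of the clique \<open>KA p (j - 1)\<close>; the
  third corner has index 2, which is where \<open>p2\<close> enters.\<close>

lemma face_avoids_barrier:
  assumes g: "g \<in> faces V (graph_edges p r) f (straight f)" and j: "0 < j" "j \<le> p * Suc r"
  shows "g \<inter> frontier (barrier j) = {}"
proof -
  have avoid: "g \<inter> closed_segment (f (vA j a)) (f (vA j b)) = {}" if "a \<noteq> b" "a \<le> 2" "b \<le> 2" for a b
  proof -
    obtain l where l: "j = Suc l" using j(1) by (cases j) auto
    have "{vA j a, vA j b} \<in> clique (KA p l)" using that l p2 by (auto simp: clique_def KA_def)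
    moreover have "l < Suc (p * Suc r)" using j l by simp
    ultimately have "{vA j a, vA j b} \<in> graph_edges p r" unfolding graph_edges_def by blast
    moreover have "g \<subseteq> - (f ` V \<union> (\<Union>e\<in>graph_edges p r. path_image (straight f e)))"
      using g in_components_subset unfolding faces_def by blast
    ultimately show ?thesis using path_image_straight[of f "vA j a" "vA j b"] by blast
  qed
  have "frontier (barrier j) = closed_segment (f (vA j 1)) (f (vA j 2)) \<union> closed_segment (f (vA j 2)) (f (vA j 0))
      \<union> closed_segment (f (vA j 0)) (f (vA j 1))"
    unfolding barrier_def by (rule frontier_of_triangle) simp
  then show ?thesis using avoid[of 1 2] avoid[of 2 0] avoid[of 0 1] by (simp add: Int_Un_distrib)
qed

text \<open>The barriers of levels \<open>m + 2\<close> to \<open>m'\<close> separate the ends,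
  since the first cut edge lies inside barrier \<open>m + 1\<close> and the second outside the
  interior of barrier \<open>m'\<close>.\<close>

lemma walk_length:
  assumes walk: "radial_walk P (faces V (graph_edges p r) f (straight f)) u v n"
    and m: "m < m'" "m' \<le> p * Suc r"
    and u: "u \<in> closed_segment (f (vA m 1)) (f (vB m 0))"
    and v: "v \<in> closed_segment (f (vA m' 1)) (f (vB m' 0))"
  shows "m' \<le> Suc m + n"
proof (rule radial_walk_nested[where D = barrier, OF walk])
  show "connected g" if "g \<in> faces V (graph_edges p r) f (straight f)" for g
    using that in_components_connected by (auto simp: faces_def)
  show "g \<inter> frontier (barrier j) = {}"
    if "g \<in> faces V (graph_edges p r) f (straight f)" "Suc m < j" "j \<le> m'" for g j
    using face_avoids_barrier[OF that(1), of j] that(2,3) m by simp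
  show "u \<in> barrier (Suc m)" using cut_edge_in_barrier u by blast
  show "v \<notin> interior (barrier m')" by (rule cut_edge_outside_barrier[OF v])
qed (use closed_barrier barriers_nested in auto)

lemma face_distance_cut_edges:
  assumes sub: "subdivision_placement (graph_edges p r) (straight f) sub"
    and t: "t1 \<in> cut_edges p r" "t2 \<in> cut_edges p r" "t1 \<noteq> t2"
  shows "enat r \<le> dF_tilde V (graph_edges p r) f (straight f) sub (sub t1) (sub t2)"
  unfolding dF_tilde_def face_distance_def
proof (rule Inf_greatest, clarify)
  fix n assume walk: "radial_walk (tilde_vertices V (graph_edges p r) f (straight f) sub)
    (faces V (graph_edges p r) f (straight f)) (sub t1) (sub t2) n"
  obtain i1 where i1: "i1 < p" "t1 = cut_edge (Suc i1 * Suc r)" "Suc i1 * Suc r \<le> p * Suc r" using cut_edgesE[OF t(1)] .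
  obtain i2 where i2: "i2 < p" "t2 = cut_edge (Suc i2 * Suc r)" "Suc i2 * Suc r \<le> p * Suc r" using cut_edgesE[OF t(2)] .
  have on: "sub (cut_edge m) \<in> closed_segment (f (vA m 1)) (f (vB m 0))" if "cut_edge m \<in> cut_edges p r" for m
  proof -
    have "cut_edge m \<in> graph_edges p r" using that by (simp add: graph_edges_def)
    then obtain \<tau> where "\<tau> \<in> {0<..<1}" "sub (cut_edge m) = straight f (cut_edge m) \<tau>"
      using sub unfolding subdivision_placement_def by blast
    then have "sub (cut_edge m) \<in> path_image (straight f (cut_edge m))" by (auto simp: path_image_def)
    then show ?thesis by (simp add: cut_edge_def path_image_straight)
  qed
  have gap: "r \<le> n" if lt: "i < i'" "i' < p" and le: "Suc i' * Suc r \<le> Suc (Suc i * Suc r) + n" for i i'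
  proof -
    have "Suc (Suc i) * Suc r \<le> Suc i' * Suc r" using lt by (intro mult_le_mono1) simp
    then show ?thesis using le by simp
  qed
  have lt: "Suc i * Suc r < Suc i' * Suc r" if "i < i'" for i i' :: nat
    using that by (intro mult_less_mono1) auto
  have "i1 \<noteq> i2" using t(3) i1 i2 by auto
  then consider "i1 < i2" | "i2 < i1" by linarith
  then have "r \<le> n"
  proof cases
    case 1
    then show ?thesis using walk_length[OF walk lt[OF 1] i2(3)] on t i1 i2 gap[of i1 i2] by blast
  next
    case 2
    then show ?thesis using walk_length[OF radial_walk_sym[OF walk] lt[OF 2] i1(3)] on t i1 i2 gap[of i2 i1] by blast
  qed
  then show "enat r \<le> enat n" by simp
qed

end

text \<open>Integrality sharpens the hypothesis to \<open>p + 1 \<le> 2 * s\<close>. Squaring gains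
  \<open>2 * p + 1 \<ge> 5\<close>, which covers the 4, and \<open>2 * s \<le> s * s\<close> gives
  the second bound.\<close>

lemma sqrt_floor_bounds:
  fixes k p :: nat
  assumes "2 \<le> p" "real p < 2 * real_of_int \<lfloor>sqrt (real k)\<rfloor>"
  shows "p\<^sup>2 + 4 \<le> 4 * k" "p + 1 \<le> k"
proof -
  define s where "s = nat \<lfloor>sqrt (real k)\<rfloor>"
  have s: "real_of_int \<lfloor>sqrt (real k)\<rfloor> = real s" by (simp add: s_def)
  have "real s \<le> sqrt (real k)" unfolding s[symmetric] by simp
  then have "(real s)\<^sup>2 \<le> (sqrt (real k))\<^sup>2" by (intro power_mono) auto
  then have "(real s)\<^sup>2 \<le> real k" by simp
  then have sk: "s * s \<le> k" by (simp add: power2_eq_square flip: of_nat_mult)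
  have ps: "p + 1 \<le> 2 * s" using assms(2) unfolding s by linarith
  then have s2: "2 \<le> s" using assms(1) by linarith
  have "2 * s \<le> s * s" using s2 by simp
  then show "p + 1 \<le> k" using ps sk by linarith
  have "(p + 1) * (p + 1) \<le> (2 * s) * (2 * s)" using ps by (intro mult_mono) auto
  then show "p\<^sup>2 + 4 \<le> 4 * k" using sk assms(1) by (simp add: power2_eq_square)
qed

theorem mainTheorem14:
  fixes k p r :: nat
  assumes "k > 0" and "p > 0" and "r > 0"
    and "real p < 2 * real_of_int \<lfloor>sqrt (real k)\<rfloor>"
  shows "\<exists>(V :: nat set) (E :: nat set set) (pos :: nat \<Rightarrow> complex)
            (c :: nat set \<Rightarrow> real \<Rightarrow> complex) (T :: nat set set).
           simple_graph V E \<and> k_plane k V E pos c \<and>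
           unique_min_edge_cut V E T \<and> card T = p \<and>
           (\<forall>sub. subdivision_placement E c sub \<longrightarrow>
              (\<forall>t1\<in>T. \<forall>t2\<in>T. t1 \<noteq> t2 \<longrightarrow>
                 enat r \<le> dF_tilde V E pos c sub (sub t1) (sub t2)))"
proof -
  obtain f where f: "\<And>n. f n \<in> box n" "general_position f"
    using general_position_exists[of box] open_box box_nonempty by metis
  show ?thesis
  proof (cases "p \<ge> 2")
    case True
    interpret placed p f by unfold_locales (use True f in auto)
    have sg: "simple_graph (VA p r \<union> VB p r) (graph_edges p r)" by (rule graph_simple[OF assms(2)])
    moreover have "k_plane k (VA p r \<union> VB p r) (graph_edges p r) f (straight f)"
      by (rule straight_k_plane[OF f(2) sg]) (rule crossing_count[OF sqrt_floor_bounds[OF True assms(4)]])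
    ultimately show ?thesis using cut_edges_unique[OF assms(2)] card_cut_edges face_distance_cut_edges by blast
  next
    case False
    \<comment> \<open>For \<open>k = 1\<close> the crossing budget of the construction fails as
      well. A single edge is its own unique minimum cut, and the distance condition is
      vacuous.\<close>
    then have p: "p = 1" using assms(2) by simp
    define V E where "V = {0, 1 :: nat}" and "E = {{0, 1 :: nat}}"
    have sg: "simple_graph V E" by (simp add: simple_graph_def V_def E_def)
    have "crossing_edges E f e = {}" if "e \<in> E" for e using that by (auto simp: crossing_edges_def E_def)
    then have "k_plane k V E f (straight f)" by (intro straight_k_plane[OF f(2) sg]) simp
    moreover have "unique_min_edge_cut V E E"
    proof -
      have "\<not> graph_connected V {}" by (auto simp: graph_connected_def V_def)
      then have "edge_cut V E E" by (simp add: edge_cut_def)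
      moreover have "T = E" if "edge_cut V E T" for T
      proof -
        have "(0, 1) \<in> {(x, y). {x, y} \<in> E}" "(1, 0) \<in> {(x, y). {x, y} \<in> E}" by (auto simp: E_def insert_commute)
        then have "graph_connected V E" unfolding graph_connected_def V_def by auto
        then have "T \<noteq> {}" using that by (auto simp: edge_cut_def)
        then show ?thesis using that by (auto simp: edge_cut_def E_def)
      qed
      ultimately show ?thesis by (auto simp: unique_min_edge_cut_def min_edge_cut_def)
    qed
    moreover have "card E = p" by (simp add: E_def p)
    moreover have "\<forall>t1\<in>E. \<forall>t2\<in>E. t1 = t2" by (simp add: E_def)
    ultimately show ?thesis using sg by blast
  qed
qed

end
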